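(* Let $n,d\ge 1$ and $\sigma>0$, and suppose Assumptions A1--A4 of the context hold for the losses $f_1,\dots,f_n$ and the comparator space $\mathcal{W}$. Let $\boldsymbol p_1,\dots,\boldsymbol p_n$ be the predictions of the FLH-SIONS algorithm (defined in the context) with parameters $\epsilon=2$, $C=20$ and exp-concavity factor $\sigma$. Then for every comparator sequence $\boldsymbol w_1,\dots,\boldsymbol w_n\in\mathcal{W}$, $$\sum_{t=1}^n \big(f_t(\boldsymbol p_t)-f_t(\boldsymbol w_t)\big)=\tilde O\Big(\max\Big\{d^2\min\big\{n^{1/5}[\mathcal{TV}_1(\boldsymbol w_{1:n})]^{2/5},\ n^{1/3}[\mathcal{TV}_0(\boldsymbol w_{1:n})]^{2/3}\big\},\ d^2\Big\}\Big).$$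
   Context: Online protocol: at each round $t=1,\dots,n$ the learner plays $\boldsymbol p_t\in\mathbb{R}^d$, then a loss $f_t:\mathbb{R}^d\to\mathbb{R}$ is revealed (possibly chosen adversarially). Assumptions. A1: all comparators $\boldsymbol w_t$ lie in a given set $\mathcal{W}\subseteq[-1,1]^d$. A2: each $f_t$ is $1$-Lipschitz in $\|\cdot\|_2$ on $[-20,20]^d$. A3: each $f_t$ is $1$-gradient Lipschitz on $[-20,20]^d$; in particular $f_t(\boldsymbol y)\le f_t(\boldsymbol x)+\nabla f_t(\boldsymbol x)^T(\boldsymbol y-\boldsymbol x)+\frac12\|\boldsymbol y-\boldsymbol x\|_2^2$ there. A4: each $f_t$ is $\sigma$ exp-concave on $[-20,20]^d$ (i.e. $e^{-\sigma f_t}$ is concave there), and $f_t(\boldsymbol y)\ge f_t(\boldsymbol x)+\nabla f_t(\boldsymbol x)^T(\boldsymbol y-\boldsymbol x)+\frac{\sigma}{2}(\nabla f_t(\boldsymbol x)^T(\boldsymbol y-\boldsymbol x))^2$ for $\boldsymbol x,\boldsymbol y\in[-20,20]^d$. Path lengths: for a sequence of vectors, $D$ is the first difference operator ($D\boldsymbol v_{1:\ell}=\boldsymbol v_2-\boldsymbol v_1,\dots,\boldsymbol v_\ell-\boldsymbol v_{\ell-1}$), $D^2=D\circ D$, the $\|\cdot\|_1$ norm of a sequence of vectors is the sum of the $\ell_1$ norms of its members (an empty sequence has norm $0$); $\mathcal{TV}_0(\boldsymbol w_{1:n})=\|D\boldsymbol w_{1:n}\|_1$ and $\mathcal{TV}_1(\boldsymbol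 w_{1:n})=n\|D^2\boldsymbol w_{1:n}\|_1$. SIONS expert $E_j$ (one for each $j\in[n]$, starting at time $j$, parameters $\epsilon,\eta,C>0$). At time $t\ge j$ it receives the co-variate $\boldsymbol x_j^{(t)}=[1,t-j+1]^T\in\mathbb{R}^2$. Put $\mathcal{K}_t=\{\boldsymbol w\in\mathbb{R}^{2d}:|(\boldsymbol x_j^{(t)})^T\boldsymbol w[2k-1:2k]|\le C\ \forall k\in[d]\}$ and $\tilde f_t(\boldsymbol v)=f_t\big((\boldsymbol x_j^{(t)})^T\boldsymbol v[1:2],\dots,(\boldsymbol x_j^{(t)})^T\boldsymbol v[2d-1:2d]\big)$ for $\boldsymbol v\in\mathbb{R}^{2d}$, where $\boldsymbol v[2k-1:2k]\in\mathbb{R}^2$ are the entries $2k-1,2k$. Initialize $\boldsymbol v_j=\boldsymbol 0$. For $t\ge j$ let $\boldsymbol A_t=\epsilon \boldsymbol I_{2d}+\eta\sum_{s=j}^t\nabla\tilde f_s(\boldsymbol v_s)\nabla\tilde f_s(\boldsymbol v_s)^T$, $\boldsymbol u_{t+1}=\boldsymbol v_t-\boldsymbol A_t^{-1}\nabla\tilde f_t(\boldsymbol v_t)$, $\boldsymbol v_{t+1}=\arg\min_{\boldsymbol w\in\mathcal{K}_{t+1}}\|\boldsymbol w-\boldsymbol u_{t+1}\|_{\boldsymbol A_t}$. The prediction $E_j(t)\in\mathbb{R}^d$ has coordinates $E_j(t)[k]=(\boldsymbol x_j^{(t)})^T\boldsymbol v_t[2k-1:2k]$. FLH-SIONS with exp-concavity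 factor $\sigma$: use the experts $E_1,\dots,E_n$ with $\epsilon=2$, $\eta=\sigma$, $C=20$. Maintain probability vectors $v_t=(v_t^{(1)},\dots,v_t^{(t)})$, $v_1^{(1)}=1$. At round $t$ play $\boldsymbol p_t=\sum_{j=1}^t v_t^{(j)}E_j(t)$. After receiving $f_t$, for $1\le i\le t$ set $\hat v_{t+1}^{(i)}=v_t^{(i)}e^{-\sigma f_t(E_i(t))}/\sum_{j=1}^t v_t^{(j)}e^{-\sigma f_t(E_j(t))}$, then $v_{t+1}^{(t+1)}=1/(t+1)$ and $v_{t+1}^{(i)}=(1-\frac1{t+1})\hat v_{t+1}^{(i)}$ for $i\le t$. $\tilde O$ hides poly-logarithmic factors of $n$: $g=\tilde O(h)$ means $g\le K(1+\log n)^{K}h$ with $K$ depending only on $\sigma$. *)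

theory Defs
  imports Complex_Main "Jordan_Normal_Form.Gauss_Jordan_Elimination"
begin

(* Vectors of R^d are elements of "carrier_vec d" rather than of a type of dimension d, because
   the constant hidden in the final bound must not depend on d.
   Coordinates are counted from 0, rounds and experts from 1. *)

definition l2norm :: "real vec \<Rightarrow> real" where
  "l2norm v = sqrt (v \<bullet> v)"

definition l1norm :: "real vec \<Rightarrow> real" where
  "l1norm v = (\<Sum>k<dim_vec v. \<bar>v $ k\<bar>)"

definition mahalanobis :: "real mat \<Rightarrow> real vec \<Rightarrow> real" where
  "mahalanobis A v = sqrt (v \<bullet> (A *\<^sub>v v))"

definition cube :: "nat \<Rightarrow> real \<Rightarrow> real vec set" where
  "cube d r = {x \<in> carrier_vec d. \<forall>k<d. \<bar>x $ k\<bar> \<le> r}"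

(* Frechet differentiability on the whole space R^d, also at boundary points of a cube. *)
definition has_gradient :: "nat \<Rightarrow> (real vec \<Rightarrow> real) \<Rightarrow> real vec \<Rightarrow> real vec \<Rightarrow> bool" where
  "has_gradient d f g x \<longleftrightarrow> g \<in> carrier_vec d \<and>
     (\<forall>e>0. \<exists>r>0. \<forall>y\<in>carrier_vec d. l2norm (y - x) < r \<longrightarrow>
        \<bar>f y - f x - g \<bullet> (y - x)\<bar> \<le> e * l2norm (y - x))"

definition grad :: "nat \<Rightarrow> (real vec \<Rightarrow> real) \<Rightarrow> real vec \<Rightarrow> real vec" where
  "grad d f x = (THE g. has_gradient d f g x)"

lemma has_gradient_unique:
  assumes x: "x \<in> carrier_vec d"
    and g: "has_gradient d f g x" and h: "has_gradient d f h x"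
  shows "g = h"
proof (rule ccontr)
  have gc: "g \<in> carrier_vec d" and hc: "h \<in> carrier_vec d"
    using g h by (auto simp: has_gradient_def)
  assume "g \<noteq> h"
  then obtain k where k: "k < d" "g $ k \<noteq> h $ k"
    using gc hc by (metis carrier_vecD eq_vecI)
  define e where "e = \<bar>g $ k - h $ k\<bar> / 4"
  have e: "e > 0" using k by (simp add: e_def)
  obtain r where r: "r > 0" and R: "\<And>y. y \<in> carrier_vec d \<Longrightarrow> l2norm (y - x) < r \<Longrightarrow>
      \<bar>f y - f x - g \<bullet> (y - x)\<bar> \<le> e * l2norm (y - x)"
    using g e unfolding has_gradient_def by blast
  obtain q where q: "q > 0" and Q: "\<And>y. y \<in> carrier_vec d \<Longrightarrow> l2norm (y - x) < q \<Longrightarrow>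
      \<bar>f y - f x - h \<bullet> (y - x)\<bar> \<le> e * l2norm (y - x)"
    using h e unfolding has_gradient_def by blast
  define s where "s = min r q / 2"
  have s: "s > 0" "s < r" "s < q" using r q by (auto simp: s_def min_def)
  define y where "y = x + s \<cdot>\<^sub>v unit_vec d k"
  have y: "y \<in> carrier_vec d" using x by (simp add: y_def)
  have yx: "y - x = s \<cdot>\<^sub>v unit_vec d k" using x by (auto simp: y_def)
  have n: "l2norm (y - x) = s" using k s unfolding yx l2norm_def by simp
  have gy: "g \<bullet> (y - x) = s * g $ k" and hy: "h \<bullet> (y - x) = s * h $ k"
    using gc hc k unfolding yx by simp_all
  have "\<bar>s * g $ k - s * h $ k\<bar> \<le> 2 * (e * s)"
    using R[OF y] Q[OF y] s unfolding n gy hy by linarith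
  also have "s * g $ k - s * h $ k = s * (g $ k - h $ k)" by (simp add: algebra_simps)
  finally have "s * \<bar>g $ k - h $ k\<bar> \<le> s * (2 * e)" using s by (simp add: abs_mult)
  then show False using s e unfolding e_def by simp
qed

lemma grad_eqI:
  assumes "x \<in> carrier_vec d" "has_gradient d f g x"
  shows "grad d f x = g"
  unfolding grad_def using assms has_gradient_unique by blast

definition lipschitz_loss :: "nat \<Rightarrow> (real vec \<Rightarrow> real) \<Rightarrow> bool" where
  "lipschitz_loss d f \<longleftrightarrow> (\<forall>x\<in>cube d 20. \<forall>y\<in>cube d 20. \<bar>f x - f y\<bar> \<le> l2norm (x - y))"

definition gradient_lipschitz_loss :: "nat \<Rightarrow> (real vec \<Rightarrow> real) \<Rightarrow> bool" where
  "gradient_lipschitz_loss d f \<longleftrightarrow>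
     (\<forall>x\<in>cube d 20. \<exists>g. has_gradient d f g x) \<and>
     (\<forall>x\<in>cube d 20. \<forall>y\<in>cube d 20. l2norm (grad d f x - grad d f y) \<le> l2norm (x - y))"

(* The quadratic lower bound with the same factor \<sigma> is not a consequence of exp-concavity;
   it is part of the assumption. *)
definition exp_concave_loss :: "nat \<Rightarrow> real \<Rightarrow> (real vec \<Rightarrow> real) \<Rightarrow> bool" where
  "exp_concave_loss d \<sigma> f \<longleftrightarrow>
     (\<forall>x\<in>cube d 20. \<forall>y\<in>cube d 20. \<forall>\<theta>\<in>{0..1}.
        exp (- \<sigma> * f ((1 - \<theta>) \<cdot>\<^sub>v x + \<theta> \<cdot>\<^sub>v y))
          \<ge> (1 - \<theta>) * exp (- \<sigma> * f x) + \<theta> * exp (- \<sigma> * f y)) \<and>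
     (\<forall>x\<in>cube d 20. \<forall>y\<in>cube d 20.
        f y \<ge> f x + grad d f x \<bullet> (y - x) + \<sigma> / 2 * (grad d f x \<bullet> (y - x))\<^sup>2)"

fun diff_seq :: "real vec list \<Rightarrow> real vec list" where
  "diff_seq (v # v' # vs) = (v' - v) # diff_seq (v' # vs)"
| "diff_seq _ = []"

definition seq_l1norm :: "real vec list \<Rightarrow> real" where
  "seq_l1norm vs = (\<Sum>v\<leftarrow>vs. l1norm v)"

definition TV0 :: "real vec list \<Rightarrow> real" where
  "TV0 ws = seq_l1norm (diff_seq ws)"

definition TV1 :: "real vec list \<Rightarrow> real" where
  "TV1 ws = real (length ws) * seq_l1norm (diff_seq (diff_seq ws))"

definition covariate :: "nat \<Rightarrow> nat \<Rightarrow> real vec" where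
  "covariate j t = vec_of_list [1, real t - real j + 1]"

definition block :: "real vec \<Rightarrow> nat \<Rightarrow> real vec" where
  "block v k = vec_of_list [v $ (2 * k), v $ (2 * k + 1)]"

definition linear_prediction :: "nat \<Rightarrow> nat \<Rightarrow> nat \<Rightarrow> real vec \<Rightarrow> real vec" where
  "linear_prediction d j t v = vec d (\<lambda>k. covariate j t \<bullet> block v k)"

definition decision_set :: "nat \<Rightarrow> real \<Rightarrow> nat \<Rightarrow> nat \<Rightarrow> real vec set" where
  "decision_set d C j t =
     {w \<in> carrier_vec (2 * d). \<forall>k<d. \<bar>covariate j t \<bullet> block w k\<bar> \<le> C}"

definition lifted_loss ::
  "nat \<Rightarrow> (nat \<Rightarrow> real vec \<Rightarrow> real) \<Rightarrow> nat \<Rightarrow> nat \<Rightarrow> real vec \<Rightarrow> real" where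
  "lifted_loss d f j t v = f t (linear_prediction d j t v)"

definition sions_gradient ::
  "nat \<Rightarrow> (nat \<Rightarrow> real vec \<Rightarrow> real) \<Rightarrow> nat \<Rightarrow> (nat \<Rightarrow> real vec) \<Rightarrow> nat \<Rightarrow> real vec" where
  "sions_gradient d f j v t = grad (2 * d) (lifted_loss d f j t) (v t)"

definition sions_matrix ::
  "nat \<Rightarrow> real \<Rightarrow> real \<Rightarrow> (nat \<Rightarrow> real vec \<Rightarrow> real) \<Rightarrow> nat \<Rightarrow> (nat \<Rightarrow> real vec) \<Rightarrow> nat \<Rightarrow> real mat" where
  "sions_matrix d \<epsilon> \<eta> f j v t =
     \<epsilon> \<cdot>\<^sub>m 1\<^sub>m (2 * d) +
     \<eta> \<cdot>\<^sub>m mat (2 * d) (2 * d)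
            (\<lambda>(a, b). \<Sum>s=j..t. sions_gradient d f j v s $ a * sions_gradient d f j v s $ b)"

(* The iterate v_(t+1) of expert j, computed from the iterates v_j, ..., v_t. *)
definition sions_step ::
  "nat \<Rightarrow> real \<Rightarrow> real \<Rightarrow> real \<Rightarrow> (nat \<Rightarrow> real vec \<Rightarrow> real) \<Rightarrow> nat \<Rightarrow> (nat \<Rightarrow> real vec) \<Rightarrow> nat \<Rightarrow> real vec"
  where
  "sions_step d \<epsilon> \<eta> C f j v t =
     (let A = sions_matrix d \<epsilon> \<eta> f j v t;
          u = v t - the (mat_inverse A) *\<^sub>v sions_gradient d f j v t
      in arg_min (\<lambda>w. mahalanobis A (w - u)) (\<lambda>w. w \<in> decision_set d C j (t + 1)))"

(* The restriction to s < t only makes the course-of-values recursion terminate; it disappears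
   in sions_iterate_Suc. *)
fun sions_iterate ::
  "nat \<Rightarrow> real \<Rightarrow> real \<Rightarrow> real \<Rightarrow> (nat \<Rightarrow> real vec \<Rightarrow> real) \<Rightarrow> nat \<Rightarrow> nat \<Rightarrow> real vec" where
  "sions_iterate d \<epsilon> \<eta> C f j t =
     (if t \<le> j then 0\<^sub>v (2 * d)
      else sions_step d \<epsilon> \<eta> C f j
             (\<lambda>s. if s < t then sions_iterate d \<epsilon> \<eta> C f j s else 0\<^sub>v (2 * d)) (t - 1))"

declare sions_iterate.simps [simp del]

lemma sions_iterate_start: "sions_iterate d \<epsilon> \<eta> C f j j = 0\<^sub>v (2 * d)"
  by (simp add: sions_iterate.simps)

lemma sions_iterate_Suc:
  assumes "j \<le> t"
  shows "sions_iterate d \<epsilon> \<eta> C f j (Suc t) =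
         sions_step d \<epsilon> \<eta> C f j (sions_iterate d \<epsilon> \<eta> C f j) t"
proof -
  define v where "v = (\<lambda>s. if s < Suc t then sions_iterate d \<epsilon> \<eta> C f j s else 0\<^sub>v (2 * d))"
  have v: "v s = sions_iterate d \<epsilon> \<eta> C f j s" if "s \<le> t" for s
    using that by (simp add: v_def)
  have g: "sions_gradient d f j v s = sions_gradient d f j (sions_iterate d \<epsilon> \<eta> C f j) s"
    if "s \<le> t" for s
    using v[OF that] by (simp add: sions_gradient_def)
  have A: "sions_matrix d \<epsilon> \<eta> f j v t = sions_matrix d \<epsilon> \<eta> f j (sions_iterate d \<epsilon> \<eta> C f j) t"
  proof -
    have "(\<Sum>s=j..t. sions_gradient d f j v s $ a * sions_gradient d f j v s $ b) =
          (\<Sum>s=j..t. sions_gradient d f j (sions_iterate d \<epsilon> \<eta> C f j) s $ a *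
                    sions_gradient d f j (sions_iterate d \<epsilon> \<eta> C f j) s $ b)" for a b
      by (rule sum.cong) (auto simp: g)
    then show ?thesis unfolding sions_matrix_def by presburger
  qed
  have "sions_iterate d \<epsilon> \<eta> C f j (Suc t) = sions_step d \<epsilon> \<eta> C f j v t"
    using assms by (subst sions_iterate.simps) (simp add: v_def)
  then show ?thesis
    by (simp add: sions_step_def A g v)
qed

definition sions_prediction ::
  "nat \<Rightarrow> real \<Rightarrow> real \<Rightarrow> real \<Rightarrow> (nat \<Rightarrow> real vec \<Rightarrow> real) \<Rightarrow> nat \<Rightarrow> nat \<Rightarrow> real vec" where
  "sions_prediction d \<epsilon> \<eta> C f j t = linear_prediction d j t (sions_iterate d \<epsilon> \<eta> C f j t)"

(* flh_weight \<sigma> f E t i is the weight v_t^(i); only 1 \<le> i \<le> t is meaningful, as rounds start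
   at 1 the value for t = 0 is a dummy. *)
fun flh_weight ::
  "real \<Rightarrow> (nat \<Rightarrow> real vec \<Rightarrow> real) \<Rightarrow> (nat \<Rightarrow> nat \<Rightarrow> real vec) \<Rightarrow> nat \<Rightarrow> nat \<Rightarrow> real" where
  "flh_weight \<sigma> f E 0 i = 0"
| "flh_weight \<sigma> f E (Suc 0) i = (if i = 1 then 1 else 0)"
| "flh_weight \<sigma> f E (Suc (Suc m)) i =
     (let t = Suc m;
          v_hat = flh_weight \<sigma> f E t i * exp (- \<sigma> * f t (E i t)) /
                  (\<Sum>j=1..t. flh_weight \<sigma> f E t j * exp (- \<sigma> * f t (E j t)))
      in if i = t + 1 then 1 / real (t + 1) else (1 - 1 / real (t + 1)) * v_hat)"

definition flh_prediction ::
  "nat \<Rightarrow> real \<Rightarrow> (nat \<Rightarrow> real vec \<Rightarrow> real) \<Rightarrow> (nat \<Rightarrow> nat \<Rightarrow> real vec) \<Rightarrow> nat \<Rightarrow> real vec" where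
  "flh_prediction d \<sigma> f E t = vec d (\<lambda>k. \<Sum>j=1..t. flh_weight \<sigma> f E t j * E j t $ k)"

definition flh_sions ::
  "nat \<Rightarrow> real \<Rightarrow> real \<Rightarrow> real \<Rightarrow> (nat \<Rightarrow> real vec \<Rightarrow> real) \<Rightarrow> nat \<Rightarrow> real vec" where
  "flh_sions d \<sigma> \<epsilon> C f t = flh_prediction d \<sigma> f (sions_prediction d \<epsilon> \<sigma> C f) t"

end

(* The comparator sequence is randomised. If a random sequence u satisfies E u_t = w_t, then
   smoothness of f_t gives E f_t(u_t) <= f_t(w_t) + E |u_t - w_t|^2 without any first-order term, so
   that no optimality conditions of an offline optimal comparator are needed and it remains to
   compete with every realisation of u. Rounding w to multiples of delta with a common uniform
   offset yields a piecewise constant u with 1 + TV0 / delta pieces on average and error delta.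
   Rounding the slopes of w instead, and restarting at w every L rounds, yields a piecewise affine u
   with about n / L + |D^2 w|_1 / delta pieces and error L * delta. On each piece FLH follows the
   expert started at its beginning, and that expert has logarithmic regret against affine sequences
   by the analysis of the online Newton step. Balancing delta and L gives the two bounds; the
   factor d^2 leaves room for bounding the determinant in the Newton step by the Leibniz formula. *)

theory Submission
  imports Defs "Jordan_Normal_Form.Determinant" "HOL-Analysis.L2_Norm"
begin

section \<open>Quadratic forms and projections\<close>

text \<open>All rounds and coordinates share one offset. Two numbers rounded with the same offset
  land on grid points whose mean distance is exactly that of the numbers, so constant stretches
  produce no break; independent offsets would separate even equal values. The offset lives in the
  analysis only: the losses of the learner do not depend on it, so a bound for each offset may be
  averaged. Restarts are forced by the accumulation of slope errors within a block. Jumps at a break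
  are free, because the new piece is served by an expert born there. Both balancings take the target
  rate K as parameter: O(K) pieces, each costing d^2 times a logarithm of n, against a squared error
  of n * d * (K / n). For K > n the Lipschitz bound suffices. Since the hidden constant must not
  depend on d, vectors live in carrier sets of variable dimension: projections come from
  completeness of the reals in each coordinate, and logarithms of d have to be paid for by powers of
  d.\<close>

lemma scalar_prod_lessThan:
  assumes "y \<in> carrier_vec m"
  shows "x \<bullet> y = (\<Sum>i<m. x $ i * y $ i)"
  using assms by (simp add: scalar_prod_def lessThan_atLeast0)

lemma scalar_prod_self_nonneg: "(x :: real vec) \<bullet> x \<ge> 0"
  by (simp add: scalar_prod_def sum_nonneg)

lemma l2norm_nonneg: "l2norm x \<ge> 0"
  by (simp add: l2norm_def scalar_prod_self_nonneg)

lemma l2norm_square: "(l2norm x)\<^sup>2 = x \<bullet> x"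
  by (simp add: l2norm_def scalar_prod_self_nonneg)

lemma l2norm_L2_set:
  assumes "x \<in> carrier_vec m"
  shows "l2norm x = L2_set (($) x) {..<m}"
  using assms by (simp add: l2norm_def L2_set_def scalar_prod_lessThan power2_eq_square)

lemma l2norm_smult: "l2norm (c \<cdot>\<^sub>v x) = \<bar>c\<bar> * l2norm x"
proof -
  have "(c \<cdot>\<^sub>v x) \<bullet> (c \<cdot>\<^sub>v x) = c\<^sup>2 * (x \<bullet> x)"
    by (simp add: scalar_prod_def sum_distrib_left power2_eq_square algebra_simps)
  then show ?thesis by (simp add: l2norm_def real_sqrt_mult)
qed

lemma scalar_prod_Cauchy_Schwarz:
  assumes "x \<in> carrier_vec m" "y \<in> carrier_vec m"
  shows "\<bar>x \<bullet> y\<bar> \<le> l2norm x * l2norm y"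
proof -
  have "\<bar>x \<bullet> y\<bar> \<le> (\<Sum>i<m. \<bar>x $ i\<bar> * \<bar>y $ i\<bar>)"
    unfolding scalar_prod_lessThan[OF assms(2)]
    by (rule order.trans[OF sum_abs]) (simp add: abs_mult)
  also have "\<dots> \<le> l2norm x * l2norm y"
    unfolding l2norm_L2_set[OF assms(1)] l2norm_L2_set[OF assms(2)] by (rule L2_set_mult_ineq)
  finally show ?thesis .
qed

lemma l2norm_le_sqrt:
  assumes "x \<in> carrier_vec m" "\<And>i. i < m \<Longrightarrow> \<bar>x $ i\<bar> \<le> c" "c \<ge> 0"
  shows "l2norm x \<le> c * sqrt m"
proof -
  have "x \<bullet> x \<le> (\<Sum>i<m. c\<^sup>2)"
    unfolding scalar_prod_lessThan[OF assms(1)] power2_eq_square[symmetric]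
    by (intro sum_mono) (use assms in \<open>simp add: abs_le_square_iff[symmetric]\<close>)
  also have "\<dots> = (c * sqrt m)\<^sup>2" by (simp add: power_mult_distrib)
  finally show ?thesis using assms(3) by (simp add: l2norm_def real_le_lsqrt)
qed

text \<open>Sequential closedness for coordinatewise convergence, the notion of limit that a
  minimizing sequence of variable dimension \<open>m\<close> delivers.\<close>

definition coordinatewise_closed :: "nat \<Rightarrow> real vec set \<Rightarrow> bool" where
  "coordinatewise_closed m S \<longleftrightarrow> (\<forall>w p. (\<forall>k::nat. w k \<in> S) \<longrightarrow> p \<in> carrier_vec m \<longrightarrow>
     (\<forall>i<m. (\<lambda>k. w k $ i) \<longlonglongrightarrow> p $ i) \<longrightarrow> p \<in> S)"

text \<open>Positive definiteness with an explicit modulus \<open>\<epsilon>\<close>, which turns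
  smallness of the form into smallness of every coordinate. Symmetry is asked of the bilinear form,
  as this is how a Gram matrix delivers it.\<close>

locale coercive_matrix =
  fixes m :: nat and \<epsilon> :: real and A :: "real mat"
  assumes carrier: "A \<in> carrier_mat m m"
    and symmetric: "\<And>x y. x \<in> carrier_vec m \<Longrightarrow> y \<in> carrier_vec m \<Longrightarrow> x \<bullet> (A *\<^sub>v y) = y \<bullet> (A *\<^sub>v x)"
    and coercive: "\<And>x. x \<in> carrier_vec m \<Longrightarrow> \<epsilon> * (x \<bullet> x) \<le> x \<bullet> (A *\<^sub>v x)"
    and pos: "\<epsilon> > 0"
begin

lemma quad_nonneg: "x \<in> carrier_vec m \<Longrightarrow> 0 \<le> x \<bullet> (A *\<^sub>v x)"
  by (rule order.trans[OF _ coercive]) (use pos in \<open>auto simp: scalar_prod_self_nonneg\<close>)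

lemma mult_carrier: "x \<in> carrier_vec m \<Longrightarrow> A *\<^sub>v x \<in> carrier_vec m"
  using carrier by simp

lemma quad_add_smult:
  assumes [simp]: "x \<in> carrier_vec m" "y \<in> carrier_vec m"
  shows "(x + \<theta> \<cdot>\<^sub>v y) \<bullet> (A *\<^sub>v (x + \<theta> \<cdot>\<^sub>v y)) =
    x \<bullet> (A *\<^sub>v x) + 2 * \<theta> * (x \<bullet> (A *\<^sub>v y)) + \<theta>\<^sup>2 * (y \<bullet> (A *\<^sub>v y))"
proof -
  note [simp] = mult_carrier
  have "A *\<^sub>v (x + \<theta> \<cdot>\<^sub>v y) = A *\<^sub>v x + \<theta> \<cdot>\<^sub>v (A *\<^sub>v y)"
    using carrier by (simp add: mult_add_distrib_mat_vec[of _ m m] mult_mat_vec[of _ m m])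
  then show ?thesis
    using symmetric[of x y]
    by (simp add: add_scalar_prod_distrib[of _ m] scalar_prod_add_distrib[of _ m] power2_eq_square
        smult_scalar_prod_distrib[of _ m] scalar_prod_smult_distrib[of _ m] algebra_simps)
qed

lemma quad_minus_swap:
  assumes [simp]: "x \<in> carrier_vec m" "y \<in> carrier_vec m"
  shows "(x - y) \<bullet> (A *\<^sub>v (x - y)) = (y - x) \<bullet> (A *\<^sub>v (y - x))"
proof -
  have e: "x - y = (- 1) \<cdot>\<^sub>v (y - x)"
    by (intro eq_vecI) (auto simp: carrier_vecD[OF assms(1)] carrier_vecD[OF assms(2)])
  show ?thesis unfolding e using carrier
    by (simp add: mult_mat_vec[of _ m m] mult_carrier
        smult_scalar_prod_distrib[of _ m] scalar_prod_smult_distrib[of _ m])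
qed

lemma det_nonzero: "det A \<noteq> 0"
proof
  assume "det A = 0"
  then obtain v where v: "v \<in> carrier_vec m" "v \<noteq> 0\<^sub>v m" "A *\<^sub>v v = 0\<^sub>v m"
    using det_0_iff_vec_prod_zero[OF carrier] by auto
  then have "\<epsilon> * (v \<bullet> v) \<le> 0" using coercive[OF v(1)] by simp
  then have "v \<bullet> v \<le> 0" using pos by (simp add: mult_le_0_iff)
  then have "(\<Sum>i<m. v $ i * v $ i) = 0"
    using scalar_prod_self_nonneg[of v] v(1) by (simp add: scalar_prod_lessThan)
  then have "\<forall>i<m. v $ i = 0" by (subst (asm) sum_nonneg_eq_0_iff) auto
  then show False using v by (auto intro: eq_vecI)
qed

text \<open>\<open>the (mat_inverse A)\<close> occurs in the algorithm and has a meaning only for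
  invertible \<open>A\<close>; the Newton analysis works with the resulting linear system.\<close>

lemma inverse_solves:
  assumes "g \<in> carrier_vec m"
  shows "the (mat_inverse A) *\<^sub>v g \<in> carrier_vec m"
    and "A *\<^sub>v (the (mat_inverse A) *\<^sub>v g) = g"
proof -
  have "A \<in> Units (ring_mat TYPE(real) m ())"
    using det_non_zero_imp_unit[OF carrier det_nonzero] .
  then obtain B where B: "mat_inverse A = Some B"
    using mat_inverse(1)[OF carrier, where b = "()"] by (cases "mat_inverse A") auto
  have AB: "A * B = 1\<^sub>m m" "B \<in> carrier_mat m m" using mat_inverse(2)[OF carrier B] by auto
  show "the (mat_inverse A) *\<^sub>v g \<in> carrier_vec m" using AB assms B by simp
  have "A *\<^sub>v (B *\<^sub>v g) = (A * B) *\<^sub>v g"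
    by (rule assoc_mult_mat_vec[OF carrier AB(2) assms, symmetric])
  then show "A *\<^sub>v (the (mat_inverse A) *\<^sub>v g) = g" using AB(1) assms B by (metis one_mult_mat_vec option.sel)
qed

lemma tendsto_quad:
  assumes c: "\<And>k. w k \<in> carrier_vec m" "p \<in> carrier_vec m"
    and l: "\<And>i. i < m \<Longrightarrow> (\<lambda>k. w k $ i) \<longlonglongrightarrow> p $ i"
  shows "(\<lambda>k. w k \<bullet> (A *\<^sub>v w k)) \<longlonglongrightarrow> p \<bullet> (A *\<^sub>v p)"
proof -
  have q: "x \<bullet> (A *\<^sub>v x) = (\<Sum>i<m. x $ i * (\<Sum>j<m. A $$ (i, j) * x $ j))"
    if x: "x \<in> carrier_vec m" for x
  proof -
    have "(A *\<^sub>v x) $ i = (\<Sum>j<m. A $$ (i, j) * x $ j)" if "i < m" for i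
      using that x carrier by (simp add: scalar_prod_lessThan[of _ m])
    then show ?thesis
      unfolding scalar_prod_lessThan[OF mult_carrier[OF x]] by (intro sum.cong) auto
  qed
  show ?thesis unfolding q[OF c(1)] q[OF c(2)] by (intro tendsto_intros l) auto
qed

text \<open>The parallelogram law, which makes minimizing sequences Cauchy; there is no compactness
  argument available for vectors of a carrier set.\<close>
lemma minimizing_sequence_bound:
  assumes [simp]: "x \<in> carrier_vec m" "y \<in> carrier_vec m"
    and mid: "c \<le> (x + (1/2) \<cdot>\<^sub>v (y - x)) \<bullet> (A *\<^sub>v (x + (1/2) \<cdot>\<^sub>v (y - x)))"
  shows "(y - x) \<bullet> (A *\<^sub>v (y - x)) \<le> 2 * (x \<bullet> (A *\<^sub>v x) + y \<bullet> (A *\<^sub>v y) - 2 * c)"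
proof -
  have "x + 1 \<cdot>\<^sub>v (y - x) = y" by (auto intro: eq_vecI simp: carrier_vecD[OF assms(1)] carrier_vecD[OF assms(2)])
  then show ?thesis
    using mid quad_add_smult[of x "y - x" "1/2"] quad_add_smult[of x "y - x" 1]
    by (simp add: power2_eq_square algebra_simps)
qed

text \<open>Pick points whose values exceed the infimum by less than \<open>1 / (k + 1)\<close>.
  Their midpoints lie in \<open>S\<close> and cannot go below the infimum, so the parallelogram law
  makes the sequence Cauchy for the form and, by coercivity, in every coordinate. The limit stays in
  \<open>S\<close> and the form is continuous.\<close>

lemma projection_exists:
  assumes u: "u \<in> carrier_vec m" and S: "S \<subseteq> carrier_vec m" "S \<noteq> {}"
    and mid: "\<And>x y. x \<in> S \<Longrightarrow> y \<in> S \<Longrightarrow> x + (1/2) \<cdot>\<^sub>v (y - x) \<in> S"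
    and closed: "coordinatewise_closed m S"
  shows "\<exists>p\<in>S. \<forall>q\<in>S. (p - u) \<bullet> (A *\<^sub>v (p - u)) \<le> (q - u) \<bullet> (A *\<^sub>v (q - u))"
proof -
  define Q where "Q w = (w - u) \<bullet> (A *\<^sub>v (w - u))" for w
  note [simp] = u
  define c where "c = Inf (Q ` S)"
  have bdd: "bdd_below (Q ` S)"
    using S(1) by (intro bdd_belowI[of _ 0]) (auto simp: Q_def intro!: quad_nonneg)
  have c: "c \<le> Q w" if "w \<in> S" for w
    unfolding c_def using bdd that by (simp add: cINF_lower)
  have "\<exists>w\<in>S. Q w < c + inverse (real (Suc k))" for k
    using cINF_less_iff[OF S(2) bdd, of "c + inverse (real (Suc k))"] by (simp add: c_def)
  then obtain w where w: "\<And>k. w k \<in> S" "\<And>k. Q (w k) < c + inverse (real (Suc k))"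
    by metis
  have wc [simp]: "w k \<in> carrier_vec m" for k using w(1) S(1) by auto
  note dims [simp] = carrier_vecD[OF u] carrier_vecD[OF wc]
  have dist: "\<epsilon> * ((w k - w l) \<bullet> (w k - w l)) \<le> 2 * (inverse (real (Suc k)) + inverse (real (Suc l)))" for k l
  proof -
    let ?x = "w l - u" and ?y = "w k - u"
    have yx: "?y - ?x = w k - w l"
      by (intro eq_vecI) auto
    have "?x + (1/2) \<cdot>\<^sub>v (w k - w l) = (w l + (1/2) \<cdot>\<^sub>v (w k - w l)) - u"
      by (intro eq_vecI) auto
    then have "c \<le> (?x + (1/2) \<cdot>\<^sub>v (?y - ?x)) \<bullet> (A *\<^sub>v (?x + (1/2) \<cdot>\<^sub>v (?y - ?x)))"
      unfolding yx using c[OF mid[OF w(1) w(1)], of l k] by (simp add: Q_def)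
    from minimizing_sequence_bound[OF _ _ this]
    have "(w k - w l) \<bullet> (A *\<^sub>v (w k - w l)) \<le> 2 * (Q (w l) + Q (w k) - 2 * c)"
      unfolding yx by (simp add: Q_def)
    then show ?thesis using w(2)[of k] w(2)[of l] coercive[of "w k - w l"] by simp
  qed
  have "convergent (\<lambda>k. w k $ i)" if i: "i < m" for i
  proof -
    have "\<epsilon> * (w k $ i - w l $ i)\<^sup>2 \<le> 2 * (inverse (real (Suc k)) + inverse (real (Suc l)))" for k l
    proof -
      have "(w k $ i - w l $ i)\<^sup>2 = (\<Sum>a\<in>{i}. (w k - w l) $ a * (w k - w l) $ a)"
        using i by (simp add: power2_eq_square)
      also have "\<dots> \<le> (\<Sum>a<m. (w k - w l) $ a * (w k - w l) $ a)"
        by (rule sum_mono2) (use i in auto)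
      also have "\<dots> = (w k - w l) \<bullet> (w k - w l)"
        by (simp add: scalar_prod_lessThan[of _ m])
      finally have "\<epsilon> * (w k $ i - w l $ i)\<^sup>2 \<le> \<epsilon> * ((w k - w l) \<bullet> (w k - w l))"
        using pos by simp
      then show ?thesis using dist[of k l] by linarith
    qed
    note D = this
    have "Cauchy (\<lambda>k. w k $ i)"
    proof (rule CauchyI)
      fix e :: real assume e: "e > 0"
      obtain M where M: "inverse (real (Suc M)) < \<epsilon> * e\<^sup>2 / 4"
        using reals_Archimedean[of "\<epsilon> * e\<^sup>2 / 4"] e pos by auto
      have "norm (w k $ i - w l $ i) < e" if "k \<ge> M" "l \<ge> M" for k l
      proof -
        have "inverse (real (Suc k)) \<le> inverse (real (Suc M))" "inverse (real (Suc l)) \<le> inverse (real (Suc M))"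
          using that by (auto intro: le_imp_inverse_le)
        then have "2 * (inverse (real (Suc k)) + inverse (real (Suc l))) \<le> 4 * inverse (real (Suc M))"
          by argo
        also have "\<dots> < \<epsilon> * e\<^sup>2" using M by argo
        finally have "\<epsilon> * (w k $ i - w l $ i)\<^sup>2 < \<epsilon> * e\<^sup>2"
          using D[of k l] by (rule le_less_trans[rotated])
        then have "(w k $ i - w l $ i)\<^sup>2 < e\<^sup>2" using pos by simp
        then show ?thesis using e power2_less_imp_less[of "norm (w k $ i - w l $ i)" e] by simp
      qed
      then show "\<exists>M. \<forall>k\<ge>M. \<forall>l\<ge>M. norm (w k $ i - w l $ i) < e" by blast
    qed
    then show ?thesis by (rule Cauchy_convergent)
  qed
  then have lim: "(\<lambda>k. w k $ i) \<longlonglongrightarrow> vec m (\<lambda>i. lim (\<lambda>k. w k $ i)) $ i" if "i < m" for i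
    using that by (simp add: convergent_LIMSEQ_iff)
  define p where "p = vec m (\<lambda>i. lim (\<lambda>k. w k $ i))"
  have pm [simp]: "p \<in> carrier_vec m" by (simp add: p_def)
  have pS: "p \<in> S"
    using closed w(1) pm lim unfolding coordinatewise_closed_def p_def by blast
  have "(\<lambda>k. Q (w k)) \<longlonglongrightarrow> Q p"
    unfolding Q_def
  proof (rule tendsto_quad)
    fix i assume i: "i < m"
    have "(\<lambda>k. w k $ i - u $ i) \<longlonglongrightarrow> p $ i - u $ i"
      using lim[OF i] by (intro tendsto_intros) (simp add: p_def)
    then show "(\<lambda>k. (w k - u) $ i) \<longlonglongrightarrow> (p - u) $ i"
      using i by simp
  qed auto
  moreover have "(\<lambda>k. c + inverse (real (Suc k))) \<longlonglongrightarrow> c + 0"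
    by (intro tendsto_intros LIMSEQ_inverse_real_of_nat)
  ultimately have "Q p \<le> c + 0"
    by (rule LIMSEQ_le) (use w(2) in \<open>auto intro: less_imp_le\<close>)
  then show ?thesis using pS c unfolding Q_def by (intro bexI[of _ p]) force+
qed

text \<open>Towards \<open>q\<close> the form has slope \<open>2 * b\<close> at \<open>p\<close>, so
  minimality forces \<open>b \<ge> 0\<close>. Expanding the form at \<open>q - u\<close> around
  \<open>p - u\<close> then leaves the form at \<open>q - p\<close> plus nonnegative terms:
  projecting moves the point no farther from \<open>q\<close>.\<close>

lemma minimizer_variational:
  assumes [simp]: "u \<in> carrier_vec m" "p \<in> carrier_vec m" "q \<in> carrier_vec m"
    and min: "\<And>\<theta>. 0 < \<theta> \<Longrightarrow> \<theta> \<le> 1 \<Longrightarrow>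
      (p - u) \<bullet> (A *\<^sub>v (p - u)) \<le> (p + \<theta> \<cdot>\<^sub>v (q - p) - u) \<bullet> (A *\<^sub>v (p + \<theta> \<cdot>\<^sub>v (q - p) - u))"
  shows "(p - q) \<bullet> (A *\<^sub>v (p - q)) \<le> (u - q) \<bullet> (A *\<^sub>v (u - q))"
proof -
  define b where "b = (p - u) \<bullet> (A *\<^sub>v (q - p))"
  define r where "r = (q - p) \<bullet> (A *\<^sub>v (q - p))"
  note dims = carrier_vecD[OF assms(1)] carrier_vecD[OF assms(2)] carrier_vecD[OF assms(3)]
  have e: "p + \<theta> \<cdot>\<^sub>v (q - p) - u = (p - u) + \<theta> \<cdot>\<^sub>v (q - p)" for \<theta>
    by (intro eq_vecI) (auto simp: dims)
  have b: "0 \<le> 2 * b + \<theta> * r" if "0 < \<theta>" "\<theta> \<le> 1" for \<theta>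
  proof -
    have "0 \<le> 2 * \<theta> * b + \<theta>\<^sup>2 * r"
      using min[OF that] quad_add_smult[of "p - u" "q - p" \<theta>] unfolding e by (simp add: b_def r_def)
    then have "0 \<le> \<theta> * (2 * b + \<theta> * r)" by (simp add: power2_eq_square algebra_simps)
    then show ?thesis using that by (simp add: zero_le_mult_iff)
  qed
  have r: "r \<ge> 0" by (simp add: r_def quad_nonneg)
  have "b \<ge> 0"
  proof (rule ccontr)
    assume nb: "\<not> b \<ge> 0"
    \<comment> \<open>Chosen so that \<open>\<theta> * r \<le> - b\<close>, which makes
      \<open>2 * b + \<theta> * r\<close> at most \<open>b < 0\<close>; the summand 1 covers
      \<open>r = 0\<close>.\<close>
    define \<theta> where "\<theta> = min 1 (- b / (r + 1))"
    have t: "0 < \<theta>" "\<theta> \<le> 1" using nb r by (auto simp: \<theta>_def divide_neg_pos)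
    have "\<theta> * r \<le> (- b / (r + 1)) * r" using r by (intro mult_right_mono) (auto simp: \<theta>_def)
    also have "\<dots> \<le> - b" using r nb by (simp add: field_simps)
    finally show False using b[OF t] nb by linarith
  qed
  have "(u - q) \<bullet> (A *\<^sub>v (u - q)) = (q - u) \<bullet> (A *\<^sub>v (q - u))"
    by (rule quad_minus_swap) auto
  also have "q - u = (p - u) + 1 \<cdot>\<^sub>v (q - p)" by (intro eq_vecI) (auto simp: dims)
  also have "\<dots> \<bullet> (A *\<^sub>v \<dots>) = (p - u) \<bullet> (A *\<^sub>v (p - u)) + 2 * b + r"
    by (subst quad_add_smult) (auto simp: b_def r_def)
  finally have "(u - q) \<bullet> (A *\<^sub>v (u - q)) \<ge> r"
    using \<open>b \<ge> 0\<close> quad_nonneg[of "p - u"] by simp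
  also have "r = (p - q) \<bullet> (A *\<^sub>v (p - q))"
    unfolding r_def by (rule quad_minus_swap) auto
  finally show ?thesis .
qed

end

section \<open>Determinants and the online Newton step\<close>

definition outer :: "nat \<Rightarrow> real vec \<Rightarrow> real vec \<Rightarrow> real mat" where
  "outer m x y = mat m m (\<lambda>(a, b). x $ a * y $ b)"

text \<open>The bordered matrix \<open>?M\<close> is multiplied by the unipotent \<open>?L\<close>
  from either side. Both products are block triangular, their determinants are the two sides of the
  claim, and \<open>det\<close> does not see the order of the factors.\<close>

lemma det_one_minus_outer:
  assumes z: "z \<in> carrier_vec m" and g: "g \<in> carrier_vec m"
  shows "det (1\<^sub>m m - outer m z g) = 1 - g \<bullet> z"
proof -
  define Z where "Z = mat m 1 (\<lambda>(i, _). z $ i)"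
  define G where "G = mat 1 m (\<lambda>(_, j). g $ j)"
  have Z: "Z \<in> carrier_mat m 1" and G: "G \<in> carrier_mat 1 m" by (auto simp: Z_def G_def)
  let ?M = "four_block_mat (1\<^sub>m m) Z G (1\<^sub>m 1)"
  let ?L = "four_block_mat (1\<^sub>m m) (0\<^sub>m m 1) (- G) (1\<^sub>m 1)"
  have M: "?M \<in> carrier_mat (m + 1) (m + 1)" and L: "?L \<in> carrier_mat (m + 1) (m + 1)"
    by (auto intro: four_block_carrier_mat)
  have ZG: "Z * (- G) = - outer m z g"
    by (intro eq_matI) (auto simp: Z_def G_def outer_def scalar_prod_def)
  have GZ: "(- G) * Z = mat 1 1 (\<lambda>_. - (g \<bullet> z))"
    using z by (intro eq_matI) (auto simp: Z_def G_def scalar_prod_def sum_negf)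
  have "?M * ?L = four_block_mat (1\<^sub>m m - outer m z g) Z (0\<^sub>m 1 m) (1\<^sub>m 1)"
    using Z G by (subst mult_four_block_mat[of _ m m _ 1 _ 1 _ _ m _ 1])
      (auto simp: ZG minus_add_uminus_mat[of _ m m] outer_def intro!: cong_four_block_mat uminus_l_inv_mat)
  also have "det \<dots> = det (1\<^sub>m m - outer m z g) * det (1\<^sub>m 1 :: real mat)"
    using Z by (intro det_four_block_mat_lower_left_zero[of _ m _ 1]) (auto simp: outer_def)
  finally have 1: "det (?M * ?L) = det (1\<^sub>m m - outer m z g)" by simp
  have "?L * ?M = four_block_mat (1\<^sub>m m) Z (0\<^sub>m 1 m) (1\<^sub>m 1 + mat 1 1 (\<lambda>_. - (g \<bullet> z)))"
    using Z G by (subst mult_four_block_mat[of _ m m _ 1 _ 1 _ _ m _ 1])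
      (auto simp: GZ intro!: cong_four_block_mat uminus_l_inv_mat comm_add_mat)
  also have "det \<dots> = det (1\<^sub>m m :: real mat) * det (1\<^sub>m 1 + mat 1 1 (\<lambda>_. - (g \<bullet> z)))"
    using Z by (intro det_four_block_mat_lower_left_zero[of _ m _ 1]) auto
  finally have 2: "det (?L * ?M) = 1 - g \<bullet> z" by (simp add: det_single)
  show ?thesis using 1 2 det_mult[OF M L] det_mult[OF L M] by simp
qed

text \<open>The Newton step inverts the matrix after the update, so \<open>z\<close> solves the
  system of \<open>B = A + c g g^T\<close>. Then \<open>B (I - c z g^T) = A\<close>, and the
  preceding determinant applies to the second factor.\<close>

lemma det_rank_one_update:
  assumes A: "A \<in> carrier_mat m m" and z: "z \<in> carrier_vec m" and g: "g \<in> carrier_vec m"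
    and solves: "(A + c \<cdot>\<^sub>m outer m g g) *\<^sub>v z = g"
  shows "det A = det (A + c \<cdot>\<^sub>m outer m g g) * (1 - c * (g \<bullet> z))"
proof -
  let ?B = "A + c \<cdot>\<^sub>m outer m g g"
  have O: "outer m x y \<in> carrier_mat m m" for x y by (simp add: outer_def)
  have B: "?B \<in> carrier_mat m m" using A O by simp
  have row: "row ?B i \<bullet> z = g $ i" if "i < m" for i
  proof -
    have "(?B *\<^sub>v z) $ i = row ?B i \<bullet> z" using that B by (intro index_mult_mat_vec) auto
    then show ?thesis by (simp only: solves)
  qed
  have "?B * outer m (c \<cdot>\<^sub>v z) g = c \<cdot>\<^sub>m outer m g g"
  proof (rule eq_matI)
    fix i j assume "i < dim_row (c \<cdot>\<^sub>m outer m g g)" "j < dim_col (c \<cdot>\<^sub>m outer m g g)"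
    then have ij: "i < m" "j < m" by (auto simp: outer_def)
    have "col (outer m (c \<cdot>\<^sub>v z) g) j = (c * g $ j) \<cdot>\<^sub>v z"
      using ij z by (intro eq_vecI) (auto simp: outer_def)
    moreover have "(?B * outer m (c \<cdot>\<^sub>v z) g) $$ (i, j) = row ?B i \<bullet> col (outer m (c \<cdot>\<^sub>v z) g) j"
      using ij carrier_matD[OF B] carrier_matD[OF O] by (intro index_mult_mat(1)) simp_all
    ultimately have "(?B * outer m (c \<cdot>\<^sub>v z) g) $$ (i, j) = row ?B i \<bullet> ((c * g $ j) \<cdot>\<^sub>v z)"
      by (simp only:)
    also have "\<dots> = (c * g $ j) * (row ?B i \<bullet> z)"
      using ij B z by (intro scalar_prod_smult_distrib[of _ m]) auto
    finally show "(?B * outer m (c \<cdot>\<^sub>v z) g) $$ (i, j) = (c \<cdot>\<^sub>m outer m g g) $$ (i, j)"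
      using ij row by (simp add: outer_def)
  qed (use B in \<open>auto simp: outer_def\<close>)
  then have "?B * (1\<^sub>m m - outer m (c \<cdot>\<^sub>v z) g) = ?B - c \<cdot>\<^sub>m outer m g g"
    using mult_minus_distrib_mat[OF B one_carrier_mat O] right_mult_one_mat[OF B] by (simp only:)
  also have "\<dots> = A" using A by (intro eq_matI) (auto simp: outer_def)
  finally have "det A = det (?B * (1\<^sub>m m - outer m (c \<cdot>\<^sub>v z) g))" by simp
  also have "\<dots> = det ?B * (1 - g \<bullet> (c \<cdot>\<^sub>v z))"
  proof -
    have "1\<^sub>m m - outer m (c \<cdot>\<^sub>v z) g \<in> carrier_mat m m" by (rule minus_carrier_mat[OF O])
    from det_mult[OF B this] show ?thesis using det_one_minus_outer[of "c \<cdot>\<^sub>v z" m g] z g by simp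
  qed
  finally show ?thesis using z g by (simp add: scalar_prod_smult_distrib[of _ m])
qed

text \<open>The Leibniz expansion has \<open>m!\<close> summands of at most \<open>M ^ m\<close>
  each, and \<open>m! \<le> m ^ m\<close>.\<close>

lemma det_le_entry_bound:
  fixes A :: "real mat"
  assumes A: "A \<in> carrier_mat m m" and M: "\<And>i j. i < m \<Longrightarrow> j < m \<Longrightarrow> \<bar>A $$ (i, j)\<bar> \<le> M"
  shows "det A \<le> (real m * M) ^ m"
proof (cases "m = 0")
  case True then show ?thesis using A by (simp add: det_dim_zero)
next
  case False
  have M0: "M \<ge> 0" using M[of 0 0] False by linarith
  have "det A \<le> (\<Sum>p\<in>{p. p permutes {0..<m}}. M ^ m)"
    unfolding det_def'[OF A]
  proof (rule sum_mono)
    fix p assume "p \<in> {p. p permutes {0..<m}}"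
    then have p: "p i < m" if "i < m" for i
      using that permutes_in_image[of p "{0..<m}" i] by auto
    have "signof p * (\<Prod>i = 0..<m. A $$ (i, p i)) \<le> \<bar>\<Prod>i = 0..<m. A $$ (i, p i)\<bar>"
      by (auto simp: sign_def)
    also have "\<dots> \<le> (\<Prod>i = 0..<m. M)"
      unfolding abs_prod by (intro prod_mono) (use M p in auto)
    finally show "signof p * (\<Prod>i = 0..<m. A $$ (i, p i)) \<le> M ^ m" by simp
  qed
  also have "\<dots> = fact m * M ^ m" by (simp add: card_permutations[OF refl])
  also have "\<dots> \<le> real (m ^ m) * M ^ m"
    using M0 fact_le_power[of m, where 'a = real] by (intro mult_right_mono) auto
  finally show ?thesis by (simp add: power_mult_distrib)
qed

text \<open>The matrix of the algorithm with an arbitrary vector sequence in place of its gradients.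
  For \<open>t < j\<close> the sum is empty and \<open>\<epsilon>\<close> times the identity
  remains.\<close>

definition regularized_gram ::
  "nat \<Rightarrow> real \<Rightarrow> real \<Rightarrow> (nat \<Rightarrow> real vec) \<Rightarrow> nat \<Rightarrow> nat \<Rightarrow> real mat" where
  "regularized_gram m \<epsilon> \<eta> g j t =
     \<epsilon> \<cdot>\<^sub>m 1\<^sub>m m + \<eta> \<cdot>\<^sub>m mat m m (\<lambda>(a, b). \<Sum>s=j..t. g s $ a * g s $ b)"

lemma regularized_gram_carrier: "regularized_gram m \<epsilon> \<eta> g j t \<in> carrier_mat m m"
  by (simp add: regularized_gram_def)

lemma regularized_gram_Suc:
  assumes "j \<le> Suc t"
  shows "regularized_gram m \<epsilon> \<eta> g j (Suc t) =
    regularized_gram m \<epsilon> \<eta> g j t + \<eta> \<cdot>\<^sub>m outer m (g (Suc t)) (g (Suc t))"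
  using assms by (intro eq_matI) (auto simp: regularized_gram_def outer_def algebra_simps)

lemma regularized_gram_bilinear:
  assumes g: "\<And>s. j \<le> s \<Longrightarrow> s \<le> t \<Longrightarrow> g s \<in> carrier_vec m"
    and x: "x \<in> carrier_vec m" and y: "y \<in> carrier_vec m"
  shows "x \<bullet> (regularized_gram m \<epsilon> \<eta> g j t *\<^sub>v y) =
    \<epsilon> * (x \<bullet> y) + \<eta> * (\<Sum>s=j..t. (g s \<bullet> x) * (g s \<bullet> y))"
proof -
  let ?A = "regularized_gram m \<epsilon> \<eta> g j t"
  have "(?A *\<^sub>v y) $ i = \<epsilon> * y $ i + \<eta> * (\<Sum>s=j..t. g s $ i * (g s \<bullet> y))" if i: "i < m" for i
  proof -
    have "(?A *\<^sub>v y) $ i = (\<Sum>k<m. ((if i = k then \<epsilon> else 0) + \<eta> * (\<Sum>s=j..t. g s $ i * g s $ k)) * y $ k)"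
      using i y regularized_gram_carrier[of m \<epsilon> \<eta> g j t]
      by (auto simp: scalar_prod_lessThan[of _ m] regularized_gram_def intro!: sum.cong)
    also have "\<dots> = (\<Sum>k<m. (if i = k then \<epsilon> * y $ k else 0)) + (\<Sum>k<m. \<Sum>s=j..t. \<eta> * (g s $ i * (g s $ k * y $ k)))"
      unfolding sum.distrib[symmetric]
      by (rule sum.cong) (auto simp: sum_distrib_left sum_distrib_right algebra_simps)
    also have "(\<Sum>k<m. (if i = k then \<epsilon> * y $ k else 0)) = \<epsilon> * y $ i"
      using i by simp
    also have "(\<Sum>k<m. \<Sum>s=j..t. \<eta> * (g s $ i * (g s $ k * y $ k))) =
        \<eta> * (\<Sum>s=j..t. g s $ i * (g s \<bullet> y))"
      by (subst sum.swap) (simp add: scalar_prod_lessThan[OF y] sum_distrib_left)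
    finally show ?thesis .
  qed
  then have "x \<bullet> (?A *\<^sub>v y) = (\<Sum>i<m. x $ i * (\<epsilon> * y $ i + \<eta> * (\<Sum>s=j..t. g s $ i * (g s \<bullet> y))))"
    using mult_mat_vec_carrier[OF regularized_gram_carrier y]
    by (subst scalar_prod_lessThan[of _ m]) auto
  also have "\<dots> = \<epsilon> * (\<Sum>i<m. x $ i * y $ i) + (\<Sum>i<m. \<Sum>s=j..t. \<eta> * ((g s $ i * x $ i) * (g s \<bullet> y)))"
    by (auto simp: sum.distrib[symmetric] sum_distrib_left algebra_simps intro!: sum.cong)
  also have "(\<Sum>i<m. \<Sum>s=j..t. \<eta> * ((g s $ i * x $ i) * (g s \<bullet> y))) = \<eta> * (\<Sum>s=j..t. (g s \<bullet> x) * (g s \<bullet> y))"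
    by (subst sum.swap) (simp add: scalar_prod_lessThan[OF x] sum_distrib_left sum_distrib_right)
  finally show ?thesis by (simp add: scalar_prod_lessThan[OF y])
qed

lemma regularized_gram_coercive:
  assumes g: "\<And>s. j \<le> s \<Longrightarrow> s \<le> t \<Longrightarrow> g s \<in> carrier_vec m" and "\<epsilon> > 0" "\<eta> \<ge> 0"
  shows "coercive_matrix m \<epsilon> (regularized_gram m \<epsilon> \<eta> g j t)"
proof
  fix x y :: "real vec" assume c: "x \<in> carrier_vec m" "y \<in> carrier_vec m"
  show "x \<bullet> (regularized_gram m \<epsilon> \<eta> g j t *\<^sub>v y) = y \<bullet> (regularized_gram m \<epsilon> \<eta> g j t *\<^sub>v x)"
    using c by (simp add: regularized_gram_bilinear[OF g] comm_scalar_prod[of x m y] mult.commute)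
next
  fix x :: "real vec" assume c: "x \<in> carrier_vec m"
  show "\<epsilon> * (x \<bullet> x) \<le> x \<bullet> (regularized_gram m \<epsilon> \<eta> g j t *\<^sub>v x)"
    using c assms(3) by (simp add: regularized_gram_bilinear[OF g] sum_nonneg)
qed (use assms regularized_gram_carrier in auto)

context
  fixes m j n :: nat and \<epsilon> \<eta> :: real and g z :: "nat \<Rightarrow> real vec" and A
  defines "A \<equiv> regularized_gram m \<epsilon> \<eta> g j"
  assumes g: "\<And>s. j \<le> s \<Longrightarrow> s \<le> n \<Longrightarrow> g s \<in> carrier_vec m"
    and z: "\<And>s. j \<le> s \<Longrightarrow> s \<le> n \<Longrightarrow> z s \<in> carrier_vec m"
    and solves: "\<And>s. j \<le> s \<Longrightarrow> s \<le> n \<Longrightarrow> A s *\<^sub>v z s = g s"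
    and pos: "\<epsilon> > 0" "\<eta> > 0" "j \<ge> 1"
begin

text \<open>Elliptical potential: with \<open>q = g^T A^-1 g\<close> for the updated matrix
  \<open>A\<close>, undoing the update multiplies the determinant by \<open>1 - \<eta> * q\<close>,
  and \<open>ln (1 - x) \<le> - x\<close> makes the sum telescope. It starts one round before
  \<open>j\<close>, where the determinant is \<open>\<epsilon> ^ m\<close>.\<close>

lemma log_det_potential:
  assumes "j - 1 \<le> t" "t \<le> n"
  shows "det (A t) > 0 \<and> \<eta> * (\<Sum>s=j..t. g s \<bullet> z s) \<le> ln (det (A t)) - m * ln \<epsilon>"
  using assms
proof (induction t rule: dec_induct)
  case base
  have "A (j - 1) = \<epsilon> \<cdot>\<^sub>m 1\<^sub>m m" using pos by (intro eq_matI) (auto simp: A_def regularized_gram_def)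
  then show ?case using pos by (simp add: ln_realpow)
next
  case (step t)
  have IH: "det (A t) > 0" "\<eta> * (\<Sum>s=j..t. g s \<bullet> z s) \<le> ln (det (A t)) - m * ln \<epsilon>"
    using step by auto
  have j: "j \<le> Suc t" using step by simp
  have gz: "g (Suc t) \<in> carrier_vec m" "z (Suc t) \<in> carrier_vec m"
    using g z j step by auto
  define q where "q = g (Suc t) \<bullet> z (Suc t)"
  have e: "A (Suc t) = A t + \<eta> \<cdot>\<^sub>m outer m (g (Suc t)) (g (Suc t))"
    unfolding A_def by (rule regularized_gram_Suc[OF j])
  have dt: "det (A t) = det (A (Suc t)) * (1 - \<eta> * q)"
  proof -
    have "A t \<in> carrier_mat m m" by (simp add: A_def regularized_gram_carrier)
    moreover have "(A t + \<eta> \<cdot>\<^sub>m outer m (g (Suc t)) (g (Suc t))) *\<^sub>v z (Suc t) = g (Suc t)"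
      unfolding e[symmetric] using solves j step by simp
    ultimately show ?thesis unfolding e q_def using gz by (intro det_rank_one_update)
  qed
  \<comment> \<open>Of the Gram form at \<open>z\<close> only the newest summand is kept. It equals
    \<open>q * q\<close>, hence \<open>\<eta> * q \<le> 1\<close>; equality is impossible because
    the old determinant is nonzero.\<close>
  have "q = z (Suc t) \<bullet> (A (Suc t) *\<^sub>v z (Suc t))"
    using solves[of "Suc t"] j step gz by (simp add: q_def comm_scalar_prod[of _ m])
  also have "\<dots> = \<epsilon> * (z (Suc t) \<bullet> z (Suc t)) + \<eta> * (\<Sum>s=j..Suc t. (g s \<bullet> z (Suc t)) * (g s \<bullet> z (Suc t)))"
    unfolding A_def using g gz step by (intro regularized_gram_bilinear) auto
  also have "\<dots> \<ge> 0 + \<eta> * (\<Sum>s\<in>{Suc t}. (g s \<bullet> z (Suc t)) * (g s \<bullet> z (Suc t)))"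
    using pos j by (intro add_mono mult_left_mono sum_mono2) (auto simp: scalar_prod_self_nonneg)
  finally have q: "\<eta> * (q * q) \<le> q" by (simp add: q_def)
  have q0: "q \<ge> 0" by (rule order.trans[OF _ q]) (use pos in simp)
  have "\<eta> * q \<le> 1"
  proof (cases "q = 0")
    case False
    then have "(\<eta> * q) * q \<le> 1 * q" using q by (simp add: algebra_simps)
    then show ?thesis using False q0 by simp
  qed simp
  moreover have "1 - \<eta> * q \<noteq> 0" using dt IH(1) by auto
  ultimately have q1: "1 - \<eta> * q > 0" by linarith
  have d: "det (A (Suc t)) > 0" using dt IH(1) q1 by (simp add: zero_less_mult_iff)
  have "ln (det (A t)) = ln (det (A (Suc t))) + ln (1 - \<eta> * q)"
    unfolding dt using d q1 by (rule ln_mult_pos)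
  also have "ln (1 - \<eta> * q) \<le> - (\<eta> * q)" using ln_le_minus_one[OF q1] by simp
  finally have "\<eta> * q \<le> ln (det (A (Suc t))) - ln (det (A t))" by simp
  moreover have "(\<Sum>s=j..Suc t. g s \<bullet> z s) = (\<Sum>s=j..t. g s \<bullet> z s) + q"
    using j by (simp add: q_def)
  ultimately show ?case using IH(2) d by (simp add: distrib_left)
qed

text \<open>The induction carries the distance of the step before its projection, because the last
  iterate is not projected with respect to a set that contains the comparator.\<close>
lemma newton_step_regret:
  assumes v: "\<And>s. j \<le> s \<Longrightarrow> s \<le> n \<Longrightarrow> v s \<in> carrier_vec m" and q: "q \<in> carrier_vec m"
    and proj: "\<And>s. j \<le> s \<Longrightarrow> s < n \<Longrightarrow> (v (Suc s) - q) \<bullet> (A s *\<^sub>v (v (Suc s) - q))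
      \<le> (v s - z s - q) \<bullet> (A s *\<^sub>v (v s - z s - q))"
    and t: "j \<le> t" "t \<le> n"
  shows "2 * (\<Sum>s=j..t. g s \<bullet> (v s - q)) + (v t - z t - q) \<bullet> (A t *\<^sub>v (v t - z t - q))
    \<le> (\<Sum>s=j..t. g s \<bullet> z s) + \<eta> * (\<Sum>s=j..t. (g s \<bullet> (v s - q))\<^sup>2) + \<epsilon> * ((v j - q) \<bullet> (v j - q))"
proof -
  \<comment> \<open>Since \<open>A t\<close> maps \<open>z t\<close> to \<open>g t\<close>, the
    cross term of the expanded form is the linearised regret of the round.\<close>
  have exp: "(v t - z t - q) \<bullet> (A t *\<^sub>v (v t - z t - q)) =
      (v t - q) \<bullet> (A t *\<^sub>v (v t - q)) - 2 * (g t \<bullet> (v t - q)) + g t \<bullet> z t"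
    if t: "j \<le> t" "t \<le> n" for t
  proof -
    interpret coercive_matrix m \<epsilon> "A t"
      unfolding A_def by (rule regularized_gram_coercive) (use g t pos in auto)
    note c = v[OF t] z[OF t] q g[OF t]
    have "v t - z t - q = (v t - q) + (- 1) \<cdot>\<^sub>v z t"
      using c by (intro eq_vecI) auto
    then show ?thesis
      using quad_add_smult[of "v t - q" "z t" "-1"] c solves[OF t]
      by (simp add: comm_scalar_prod[of _ m "g t"])
  qed
  show ?thesis using t
  proof (induction t rule: dec_induct)
    case base
    have "(v j - q) \<bullet> (A j *\<^sub>v (v j - q)) = \<epsilon> * ((v j - q) \<bullet> (v j - q)) + \<eta> * (g j \<bullet> (v j - q))\<^sup>2"
      unfolding A_def using g v q base
      by (subst regularized_gram_bilinear) (auto simp: power2_eq_square)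
    then show ?case using exp[of j] base by simp
  next
    case (step t)
    let ?x = "v (Suc t) - q"
    have x: "?x \<in> carrier_vec m" using q v[of "Suc t"] step by simp
    \<comment> \<open>Enlarging the matrix costs the square of the linearised regret; the quadratic
      lower bound of exp-concave losses will pay for these squares.\<close>
    have "?x \<bullet> (A (Suc t) *\<^sub>v ?x) = ?x \<bullet> (A t *\<^sub>v ?x) + \<eta> * (g (Suc t) \<bullet> ?x)\<^sup>2"
      unfolding A_def using g x step
      by (subst (1 2) regularized_gram_bilinear[where m = m]) (auto simp: power2_eq_square algebra_simps)
    moreover have "?x \<bullet> (A t *\<^sub>v ?x) \<le> (v t - z t - q) \<bullet> (A t *\<^sub>v (v t - z t - q))"
      using proj step by simp
    moreover have "(\<Sum>s=j..Suc t. h s) = (\<Sum>s=j..t. h s) + h (Suc t)" for h :: "nat \<Rightarrow> real"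
      using step by simp
    ultimately show ?case using exp[of "Suc t"] step by (simp add: distrib_left)
  qed
qed

end

section \<open>Gradients of lifted losses\<close>

lemma linear_prediction_carrier: "linear_prediction d j t v \<in> carrier_vec d"
  by (simp add: linear_prediction_def)

lemma covariate_block: "covariate j t \<bullet> block v k = v $ (2 * k) + (real t - real j + 1) * v $ (2 * k + 1)"
  by (simp add: covariate_def block_def scalar_prod_def vec_of_list_index)

lemma linear_prediction_index:
  "k < d \<Longrightarrow> linear_prediction d j t v $ k = v $ (2 * k) + (real t - real j + 1) * v $ (2 * k + 1)"
  by (simp add: linear_prediction_def covariate_block)

lemma linear_prediction_minus:
  assumes "v \<in> carrier_vec (2 * d)" "w \<in> carrier_vec (2 * d)"
  shows "linear_prediction d j t (v - w) = linear_prediction d j t v - linear_prediction d j t w"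
proof (rule eq_vecI)
  fix k assume "k < dim_vec (linear_prediction d j t v - linear_prediction d j t w)"
  then have "k < d" by (simp add: linear_prediction_def)
  then show "linear_prediction d j t (v - w) $ k = (linear_prediction d j t v - linear_prediction d j t w) $ k"
    using assms by (simp add: linear_prediction_index linear_prediction_carrier[THEN carrier_vecD] algebra_simps)
qed (simp add: linear_prediction_def)

lemma sum_pairs: "(\<Sum>i<2 * d. h i) = (\<Sum>k<d. h (2 * k) + h (2 * k + 1))" for h :: "nat \<Rightarrow> real"
  by (induction d) auto

lemma l2norm_linear_prediction_le:
  assumes "w \<in> carrier_vec (2 * d)"
  shows "l2norm (linear_prediction d j t w) \<le> sqrt (1 + (real t - real j + 1)\<^sup>2) * l2norm w"
proof -
  define \<tau> where "\<tau> = real t - real j + 1"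
  have "linear_prediction d j t w \<bullet> linear_prediction d j t w
      = (\<Sum>k<d. (w $ (2 * k) + \<tau> * w $ (2 * k + 1))\<^sup>2)"
    by (subst scalar_prod_lessThan[OF linear_prediction_carrier])
      (auto simp: linear_prediction_index \<tau>_def power2_eq_square)
  also have "\<dots> \<le> (\<Sum>k<d. (1 + \<tau>\<^sup>2) * ((w $ (2 * k))\<^sup>2 + (w $ (2 * k + 1))\<^sup>2))"
  proof (rule sum_mono)
    fix k
    have "0 \<le> (\<tau> * w $ (2 * k) - w $ (2 * k + 1))\<^sup>2" by simp
    then show "(w $ (2 * k) + \<tau> * w $ (2 * k + 1))\<^sup>2 \<le> (1 + \<tau>\<^sup>2) * ((w $ (2 * k))\<^sup>2 + (w $ (2 * k + 1))\<^sup>2)"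
      by (simp add: power2_eq_square algebra_simps)
  qed
  also have "\<dots> = (1 + \<tau>\<^sup>2) * (w \<bullet> w)"
    by (simp add: scalar_prod_lessThan[OF assms] sum_pairs sum_distrib_left power2_eq_square)
  finally show ?thesis unfolding l2norm_def real_sqrt_mult[symmetric] \<tau>_def by simp
qed

text \<open>The adjoint of \<open>linear_prediction\<close>: even indices are intercepts, odd ones
  are slopes and pick up the second entry of the covariate.\<close>

definition lift_gradient :: "nat \<Rightarrow> nat \<Rightarrow> nat \<Rightarrow> real vec \<Rightarrow> real vec" where
  "lift_gradient d j t g = vec (2 * d)
     (\<lambda>i. if even i then g $ (i div 2) else (real t - real j + 1) * g $ (i div 2))"

lemma lift_gradient_carrier: "lift_gradient d j t g \<in> carrier_vec (2 * d)"
  by (simp add: lift_gradient_def)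

lemma lift_gradient_scalar_prod:
  assumes "w \<in> carrier_vec (2 * d)"
  shows "lift_gradient d j t g \<bullet> w = g \<bullet> linear_prediction d j t w"
proof -
  have "lift_gradient d j t g \<bullet> w =
      (\<Sum>k<d. lift_gradient d j t g $ (2 * k) * w $ (2 * k) + lift_gradient d j t g $ (2 * k + 1) * w $ (2 * k + 1))"
    by (simp only: scalar_prod_lessThan[OF assms] sum_pairs)
  also have "\<dots> = (\<Sum>k<d. g $ k * linear_prediction d j t w $ k)"
    by (rule sum.cong) (auto simp: lift_gradient_def linear_prediction_index algebra_simps)
  finally show ?thesis by (simp add: scalar_prod_lessThan[OF linear_prediction_carrier])
qed

text \<open>Chain rule for a linear map of operator norm at most \<open>c\<close>: the error budget
  and the radius are both divided by \<open>c\<close>.\<close>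

lemma has_gradient_lifted_loss:
  assumes v: "v \<in> carrier_vec (2 * d)"
    and g: "has_gradient d (f t) g (linear_prediction d j t v)"
  shows "has_gradient (2 * d) (lifted_loss d f j t) (lift_gradient d j t g) v"
  unfolding has_gradient_def
proof (intro conjI allI impI lift_gradient_carrier)
  fix e :: real assume e: "e > 0"
  define c where "c = sqrt (1 + (real t - real j + 1)\<^sup>2)"
  have c: "c > 0" by (simp add: c_def add_pos_nonneg)
  obtain r where r: "r > 0" and R: "\<And>y. y \<in> carrier_vec d \<Longrightarrow> l2norm (y - linear_prediction d j t v) < r \<Longrightarrow>
      \<bar>f t y - f t (linear_prediction d j t v) - g \<bullet> (y - linear_prediction d j t v)\<bar>
        \<le> e / c * l2norm (y - linear_prediction d j t v)"
    using g e c unfolding has_gradient_def by (meson divide_pos_pos)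
  show "\<exists>r>0. \<forall>y\<in>carrier_vec (2 * d). l2norm (y - v) < r \<longrightarrow>
      \<bar>lifted_loss d f j t y - lifted_loss d f j t v - lift_gradient d j t g \<bullet> (y - v)\<bar> \<le> e * l2norm (y - v)"
  proof (intro exI[of _ "r / c"] conjI ballI impI)
    fix y :: "real vec" assume y: "y \<in> carrier_vec (2 * d)" and l: "l2norm (y - v) < r / c"
    have yv: "y - v \<in> carrier_vec (2 * d)" using y v by simp
    have b: "l2norm (linear_prediction d j t (y - v)) \<le> c * l2norm (y - v)"
      unfolding c_def by (rule l2norm_linear_prediction_le[OF yv])
    also have "\<dots> < r" using l c by (simp add: field_simps)
    finally have "\<bar>lifted_loss d f j t y - lifted_loss d f j t v - lift_gradient d j t g \<bullet> (y - v)\<bar>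
      \<le> e / c * l2norm (linear_prediction d j t (y - v))"
      using R[OF linear_prediction_carrier, of j t y]
      by (simp add: lifted_loss_def lift_gradient_scalar_prod[OF yv] linear_prediction_minus[OF y v])
    also have "\<dots> \<le> e / c * (c * l2norm (y - v))"
      using b e c by (intro mult_left_mono) auto
    finally show "\<bar>lifted_loss d f j t y - lifted_loss d f j t v - lift_gradient d j t g \<bullet> (y - v)\<bar> \<le> e * l2norm (y - v)"
      using c by simp
  qed (use r c in simp)
qed

section \<open>Cubes, bounded partial derivatives, smoothness and Jensen's inequality\<close>

lemma cube_carrier: "x \<in> cube d r \<Longrightarrow> x \<in> carrier_vec d"
  by (simp add: cube_def)

lemma cube_mono: "r \<le> s \<Longrightarrow> cube d r \<subseteq> cube d s"
  by (fastforce simp: cube_def)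

lemma cube_convex_comb:
  assumes "x \<in> cube d r" "y \<in> cube d r" "0 \<le> \<theta>" "\<theta> \<le> 1"
  shows "(1 - \<theta>) \<cdot>\<^sub>v x + \<theta> \<cdot>\<^sub>v y \<in> cube d r"
proof -
  have "\<bar>(1 - \<theta>) * x $ k + \<theta> * y $ k\<bar> \<le> r" if "k < d" for k
  proof -
    have "\<bar>(1 - \<theta>) * x $ k + \<theta> * y $ k\<bar> \<le> (1 - \<theta>) * \<bar>x $ k\<bar> + \<theta> * \<bar>y $ k\<bar>"
      using assms by (intro order.trans[OF abs_triangle_ineq]) (simp add: abs_mult)
    also have "\<dots> \<le> (1 - \<theta>) * r + \<theta> * r"
      using assms that by (intro add_mono mult_left_mono) (auto simp: cube_def)
    finally show ?thesis by (simp add: algebra_simps)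
  qed
  then show ?thesis using assms by (simp add: cube_def carrier_vecD[of x d] carrier_vecD[of y d])
qed

lemma gradient_coordinate_le:
  assumes lip: "lipschitz_loss d f" and g: "has_gradient d f g x" and x: "x \<in> cube d 20" and k: "k < d"
  shows "\<bar>g $ k\<bar> \<le> 1"
proof (rule field_le_epsilon)
  fix e :: real assume e: "e > 0"
  obtain r where r: "r > 0" and R: "\<And>y. y \<in> carrier_vec d \<Longrightarrow> l2norm (y - x) < r \<Longrightarrow>
      \<bar>f y - f x - g \<bullet> (y - x)\<bar> \<le> e * l2norm (y - x)"
    using g e unfolding has_gradient_def by blast
  have gc: "g \<in> carrier_vec d" using g by (simp add: has_gradient_def)
  have xc: "x \<in> carrier_vec d" using x by (rule cube_carrier)
  define s where "s = min (r / 2) 1"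
  have s: "0 < s" "s < r" "s \<le> 1" using r by (auto simp: s_def min_def)
  \<comment> \<open>The step goes towards 0 in coordinate \<open>k\<close> and has length at most 1,
    so it stays in the cube even from a boundary point; the Lipschitz bound is known only
    there.\<close>
  define h where "h = (if x $ k > 0 then - s else s)"
  have h: "\<bar>h\<bar> = s" using s by (simp add: h_def)
  define y where "y = x + h \<cdot>\<^sub>v unit_vec d k"
  have yx: "y - x = h \<cdot>\<^sub>v unit_vec d k"
    using xc by (intro eq_vecI) (auto simp: y_def)
  have nyx: "l2norm (y - x) = s" unfolding yx l2norm_smult h using k by (simp add: l2norm_def)
  have yk: "\<bar>x $ k + h\<bar> \<le> 20" using x k s by (force simp: cube_def h_def)
  then have y: "y \<in> cube d 20"
    using x xc k by (auto simp: cube_def y_def unit_vec_def)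
  have "\<bar>f y - f x\<bar> \<le> s" using lip x y nyx unfolding lipschitz_loss_def by metis
  moreover have "\<bar>f y - f x - g \<bullet> (y - x)\<bar> \<le> e * s"
    using R[OF cube_carrier[OF y]] s nyx by simp
  ultimately have "\<bar>g \<bullet> (y - x)\<bar> \<le> s + e * s" by linarith
  also have "g \<bullet> (y - x) = h * g $ k" using gc k unfolding yx by simp
  finally have "s * \<bar>g $ k\<bar> \<le> s * (1 + e)" by (simp add: abs_mult h algebra_simps)
  then show "\<bar>g $ k\<bar> \<le> 1 + e" using s by simp
qed

lemma grad_has_gradient:
  assumes "gradient_lipschitz_loss d f" "x \<in> cube d 20"
  shows "has_gradient d f (grad d f x) x"
  using assms grad_eqI[OF cube_carrier] unfolding gradient_lipschitz_loss_def by metis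

text \<open>The derivative is two-sided even where the segment ends, because
  \<open>has_gradient\<close> looks at the whole space. The mean value theorem thus applies to
  segments ending on the boundary of the cube.\<close>

lemma DERIV_along_segment:
  assumes g: "has_gradient d f g (x + \<theta> \<cdot>\<^sub>v z)" and x: "x \<in> carrier_vec d" and z: "z \<in> carrier_vec d"
  shows "DERIV (\<lambda>\<theta>. f (x + \<theta> \<cdot>\<^sub>v z)) \<theta> :> g \<bullet> z"
  unfolding DERIV_def
proof (rule LIM_I)
  fix e :: real assume e: "e > 0"
  define N where "N = l2norm z"
  have N: "N \<ge> 0" by (simp add: N_def l2norm_nonneg)
  \<comment> \<open>\<open>N + 1\<close> instead of \<open>N\<close> covers the direction
    \<open>z = 0\<close>.\<close>
  have "e / (N + 1) > 0" using e N by simp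
  then obtain r where r: "r > 0" and R: "\<And>y. y \<in> carrier_vec d \<Longrightarrow> l2norm (y - (x + \<theta> \<cdot>\<^sub>v z)) < r \<Longrightarrow>
      \<bar>f y - f (x + \<theta> \<cdot>\<^sub>v z) - g \<bullet> (y - (x + \<theta> \<cdot>\<^sub>v z))\<bar> \<le> e / (N + 1) * l2norm (y - (x + \<theta> \<cdot>\<^sub>v z))"
    using g unfolding has_gradient_def by blast
  have gc: "g \<in> carrier_vec d" using g by (simp add: has_gradient_def)
  show "\<exists>s>0. \<forall>h. h \<noteq> 0 \<and> norm (h - 0) < s \<longrightarrow>
      norm ((f (x + (\<theta> + h) \<cdot>\<^sub>v z) - f (x + \<theta> \<cdot>\<^sub>v z)) / h - g \<bullet> z) < e"
  proof (intro exI[of _ "r / (N + 1)"] conjI allI impI)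
    fix h :: real assume h: "h \<noteq> 0 \<and> norm (h - 0) < r / (N + 1)"
    have d: "x + (\<theta> + h) \<cdot>\<^sub>v z - (x + \<theta> \<cdot>\<^sub>v z) = h \<cdot>\<^sub>v z"
      using x z by (intro eq_vecI) (auto simp: algebra_simps)
    have "\<bar>h\<bar> * N \<le> \<bar>h\<bar> * (N + 1)" by (intro mult_left_mono) auto
    also have "\<dots> < r" using h N by (simp add: pos_less_divide_eq)
    finally have "\<bar>f (x + (\<theta> + h) \<cdot>\<^sub>v z) - f (x + \<theta> \<cdot>\<^sub>v z) - h * (g \<bullet> z)\<bar> \<le> e / (N + 1) * (\<bar>h\<bar> * N)"
      using R[of "x + (\<theta> + h) \<cdot>\<^sub>v z"] x z gc unfolding d l2norm_smult N_def[symmetric] by simp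
    also have "\<dots> < e * \<bar>h\<bar>"
    proof -
      have "N / (N + 1) < 1" using N by simp
      then have "(e * \<bar>h\<bar>) * (N / (N + 1)) < (e * \<bar>h\<bar>) * 1" using e h by (intro mult_strict_left_mono) auto
      then show ?thesis by (simp add: algebra_simps)
    qed
    also have "F - h * c = h * (F / h - c)" for F c
      using h by (simp add: right_diff_distrib)
    finally have "\<bar>h\<bar> * \<bar>(f (x + (\<theta> + h) \<cdot>\<^sub>v z) - f (x + \<theta> \<cdot>\<^sub>v z)) / h - g \<bullet> z\<bar> < \<bar>h\<bar> * e"
      by (simp add: abs_mult mult.commute)
    then show "norm ((f (x + (\<theta> + h) \<cdot>\<^sub>v z) - f (x + \<theta> \<cdot>\<^sub>v z)) / h - g \<bullet> z) < e" using h by simp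
  qed (use r N in simp)
qed

text \<open>Mean value theorem along the segment, comparing the gradient at the intermediate point
  with the one at \<open>x\<close>. This gives the constant 1 instead of 1/2, which changes the
  final constant only.\<close>

lemma smooth_upper_bound:
  assumes gl: "gradient_lipschitz_loss d f" and x: "x \<in> cube d 20" and y: "y \<in> cube d 20"
  shows "f y \<le> f x + grad d f x \<bullet> (y - x) + (l2norm (y - x))\<^sup>2"
proof -
  note xc = cube_carrier[OF x] and yc = cube_carrier[OF y]
  define p where "p \<theta> = x + \<theta> \<cdot>\<^sub>v (y - x)" for \<theta>
  have p: "p \<theta> \<in> cube d 20" if "0 \<le> \<theta>" "\<theta> \<le> 1" for \<theta>
  proof -
    have "p \<theta> = (1 - \<theta>) \<cdot>\<^sub>v x + \<theta> \<cdot>\<^sub>v y"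
      using xc yc by (intro eq_vecI) (auto simp: p_def algebra_simps)
    then show ?thesis using cube_convex_comb[OF x y that] by simp
  qed
  have "\<exists>\<theta>. 0 < \<theta> \<and> \<theta> < 1 \<and> f (p 1) - f (p 0) = (1 - 0) * (grad d f (p \<theta>) \<bullet> (y - x))"
  proof (rule MVT2)
    fix \<theta> :: real assume "0 \<le> \<theta>" "\<theta> \<le> 1"
    then have "has_gradient d f (grad d f (p \<theta>)) (p \<theta>)" by (intro grad_has_gradient[OF gl] p)
    then show "DERIV (\<lambda>\<theta>. f (p \<theta>)) \<theta> :> grad d f (p \<theta>) \<bullet> (y - x)"
      unfolding p_def using xc yc by (intro DERIV_along_segment) auto
  qed simp
  then obtain \<theta> where t: "0 < \<theta>" "\<theta> < 1" and eq: "f (p 1) - f (p 0) = grad d f (p \<theta>) \<bullet> (y - x)" by auto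
  have p1: "p 1 = y" and p0: "p 0 = x" using xc yc by (auto simp: p_def intro!: eq_vecI)
  have gx: "grad d f x \<in> carrier_vec d" and gp: "grad d f (p \<theta>) \<in> carrier_vec d"
    using grad_has_gradient[OF gl x] grad_has_gradient[OF gl p[of \<theta>]] t by (auto simp: has_gradient_def)
  have "l2norm (grad d f (p \<theta>) - grad d f x) \<le> l2norm (p \<theta> - x)"
    using gl p[of \<theta>] x t unfolding gradient_lipschitz_loss_def by auto
  also have "p \<theta> - x = \<theta> \<cdot>\<^sub>v (y - x)" using xc yc by (intro eq_vecI) (auto simp: p_def)
  also have "l2norm \<dots> \<le> 1 * l2norm (y - x)"
    unfolding l2norm_smult using t by (intro mult_right_mono) (auto simp: l2norm_nonneg)
  finally have "(grad d f (p \<theta>) - grad d f x) \<bullet> (y - x) \<le> l2norm (y - x) * l2norm (y - x)"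
    using scalar_prod_Cauchy_Schwarz[of "grad d f (p \<theta>) - grad d f x" d "y - x"] gx gp xc yc
      mult_right_mono[OF _ l2norm_nonneg[of "y - x"]] by fastforce
  moreover have "(grad d f (p \<theta>) - grad d f x) \<bullet> (y - x) = grad d f (p \<theta>) \<bullet> (y - x) - grad d f x \<bullet> (y - x)"
    using gx gp xc yc by (intro minus_scalar_prod_distrib[of _ d]) auto
  ultimately show ?thesis using eq p0 p1 by (simp add: power2_eq_square)
qed

text \<open>The weights are left unnormalised, so that dropping an element in the induction leaves a
  family of the same kind. Membership of the average in the cube is carried along, because concavity
  is known only there.\<close>

lemma exp_concave_Jensen:
  assumes ec: "exp_concave_loss d \<sigma> f" and I: "finite I" "I \<noteq> {}"
    and p: "\<And>i. i \<in> I \<Longrightarrow> p i > 0" and x: "\<And>i. i \<in> I \<Longrightarrow> x i \<in> cube d 20"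
  shows "vec d (\<lambda>k. (\<Sum>i\<in>I. p i * x i $ k) / sum p I) \<in> cube d 20 \<and>
    (\<Sum>i\<in>I. p i * exp (- \<sigma> * f (x i))) / sum p I
      \<le> exp (- \<sigma> * f (vec d (\<lambda>k. (\<Sum>i\<in>I. p i * x i $ k) / sum p I)))"
  using I p x
proof (induction I rule: finite_ne_induct)
  case (singleton i)
  have "vec d (\<lambda>k. p i * x i $ k / p i) = x i"
    using singleton(1)[of i] singleton(2)[of i] cube_carrier[of "x i" d 20] by (intro eq_vecI) auto
  then show ?case using singleton by simp
next
  case (insert a F)
  define y where "y = vec d (\<lambda>k. (\<Sum>i\<in>F. p i * x i $ k) / sum p F)"
  have IH: "y \<in> cube d 20" "(\<Sum>i\<in>F. p i * exp (- \<sigma> * f (x i))) / sum p F \<le> exp (- \<sigma> * f y)"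
    using insert.IH insert.prems unfolding y_def by auto
  have P: "sum p F > 0" using insert by (intro sum_pos) auto
  have pa: "p a > 0" and xa: "x a \<in> cube d 20" using insert.prems by auto
  define \<theta> where "\<theta> = sum p F / (p a + sum p F)"
  have t: "0 \<le> \<theta>" "\<theta> \<le> 1" and t1: "1 - \<theta> = p a / (p a + sum p F)"
    using P pa by (auto simp: \<theta>_def field_simps)
  have comb: "(p a * u + w) / (p a + sum p F) = (1 - \<theta>) * u + \<theta> * (w / sum p F)" for u w
  proof -
    have "(p a * u + w) / (p a + sum p F) = p a / (p a + sum p F) * u + sum p F / (p a + sum p F) * (w / sum p F)"
      using P by (simp add: add_divide_distrib)
    then show ?thesis by (simp only: t1) (simp add: \<theta>_def)
  qed
  have e: "vec d (\<lambda>k. (\<Sum>i\<in>insert a F. p i * x i $ k) / sum p (insert a F)) = (1 - \<theta>) \<cdot>\<^sub>v x a + \<theta> \<cdot>\<^sub>v y"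
    using insert.hyps cube_carrier[OF xa] by (intro eq_vecI) (auto simp: y_def comb)
  have "(\<Sum>i\<in>insert a F. p i * exp (- \<sigma> * f (x i))) / sum p (insert a F)
      = (1 - \<theta>) * exp (- \<sigma> * f (x a)) + \<theta> * ((\<Sum>i\<in>F. p i * exp (- \<sigma> * f (x i))) / sum p F)"
    using insert.hyps comb by simp
  also have "\<dots> \<le> (1 - \<theta>) * exp (- \<sigma> * f (x a)) + \<theta> * exp (- \<sigma> * f y)"
    using IH(2) t by (intro add_mono mult_left_mono) auto
  also have "\<dots> \<le> exp (- \<sigma> * f ((1 - \<theta>) \<cdot>\<^sub>v x a + \<theta> \<cdot>\<^sub>v y))"
    using ec xa IH(1) t unfolding exp_concave_loss_def by auto
  finally show ?case unfolding e using cube_convex_comb[OF xa IH(1) t] by simp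
qed

section \<open>Regret of FLH and of a single SIONS expert\<close>

lemma flh_weight_pos:
  assumes "1 \<le> i" "i \<le> t"
  shows "flh_weight \<sigma> f E t i > 0"
  using assms
proof (induction t arbitrary: i)
  case (Suc m)
  show ?case
  proof (cases m)
    case (Suc k)
    have IH: "flh_weight \<sigma> f E m i > 0" if "1 \<le> i" "i \<le> m" for i using Suc.IH that by blast
    then have "(\<Sum>j=1..m. flh_weight \<sigma> f E m j * exp (- \<sigma> * f m (E j m))) > 0"
      using Suc by (intro sum_pos) auto
    moreover have "1 - 1 / real (m + 1) > 0" using Suc by (simp add: field_simps)
    ultimately show ?thesis
      using IH[of i] Suc.prems unfolding Suc
      by (auto simp: Let_def Suc simp del: sum.cl_ivl_Suc intro!: mult_pos_pos divide_pos_pos)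
  qed (use Suc.prems in auto)
qed simp

lemma flh_normalizer_pos:
  "t \<ge> 1 \<Longrightarrow> (\<Sum>j=1..t. flh_weight \<sigma> f E t j * exp (- \<sigma> * f t (E j t))) > 0"
  by (intro sum_pos) (auto intro!: mult_pos_pos flh_weight_pos)

lemma flh_weight_Suc:
  assumes "1 \<le> i" "i \<le> t"
  shows "flh_weight \<sigma> f E (Suc t) i = (1 - 1 / real (t + 1)) * (flh_weight \<sigma> f E t i * exp (- \<sigma> * f t (E i t)) /
    (\<Sum>j=1..t. flh_weight \<sigma> f E t j * exp (- \<sigma> * f t (E j t))))"
  using assms by (cases t) (auto simp: Let_def simp del: sum.cl_ivl_Suc)

lemma flh_weight_new: "t \<ge> 1 \<Longrightarrow> flh_weight \<sigma> f E t t = 1 / real t"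
proof (cases t)
  case (Suc m)
  then show ?thesis by (cases m) (auto simp: Let_def)
qed simp

lemma flh_weight_sum: "t \<ge> 1 \<Longrightarrow> (\<Sum>i=1..t. flh_weight \<sigma> f E t i) = 1"
proof (induction t rule: dec_induct)
  case (step t)
  let ?Z = "\<Sum>j=1..t. flh_weight \<sigma> f E t j * exp (- \<sigma> * f t (E j t))"
  have Z: "?Z > 0" using step by (intro flh_normalizer_pos) auto
  have "(\<Sum>i=1..Suc t. flh_weight \<sigma> f E (Suc t) i) =
      (\<Sum>i=1..t. flh_weight \<sigma> f E (Suc t) i) + 1 / real (Suc t)"
    using step flh_weight_new[of "Suc t" \<sigma> f E] by simp
  also have "(\<Sum>i=1..t. flh_weight \<sigma> f E (Suc t) i) =
      (\<Sum>i=1..t. (1 - 1 / real (t + 1)) * (flh_weight \<sigma> f E t i * exp (- \<sigma> * f t (E i t)) / ?Z))"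
    by (intro sum.cong refl flh_weight_Suc) auto
  also have "\<dots> = (1 - 1 / real (t + 1)) * (?Z / ?Z)"
    by (simp only: sum_distrib_left[symmetric] sum_divide_distrib[symmetric])
  also have "?Z / ?Z = 1" using Z by simp
  finally show ?case by (simp del: sum.cl_ivl_Suc flh_weight.simps)
qed simp

text \<open>The logarithm of the weight of expert \<open>i\<close> is the potential. Jensen bounds
  the logarithm of the normalizer by \<open>- \<sigma>\<close> times the loss of the mixture, and
  the share handed to the newcomer costs \<open>ln (t + 1) - ln t\<close>.\<close>

lemma flh_round:
  assumes ec: "exp_concave_loss d \<sigma> (f t)" and E: "\<And>i. 1 \<le> i \<Longrightarrow> i \<le> t \<Longrightarrow> E i t \<in> cube d 20"
    and t: "1 \<le> t"
  shows "flh_prediction d \<sigma> f E t \<in> cube d 20"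
    and "1 \<le> i \<Longrightarrow> i \<le> t \<Longrightarrow> \<sigma> * (f t (flh_prediction d \<sigma> f E t) - f t (E i t)) \<le>
      ln (flh_weight \<sigma> f E (Suc t) i) - ln (flh_weight \<sigma> f E t i) + ln (real (t + 1)) - ln (real t)"
proof -
  let ?w = "flh_weight \<sigma> f E t" and ?p = "flh_prediction d \<sigma> f E t"
  let ?Z = "\<Sum>j=1..t. ?w j * exp (- \<sigma> * f t (E j t))"
  have Z: "?Z > 0" using t by (rule flh_normalizer_pos)
  have sum1: "sum ?w {1..t} = 1" using t by (rule flh_weight_sum)
  have J: "?p \<in> cube d 20 \<and> ?Z \<le> exp (- \<sigma> * f t ?p)"
    using exp_concave_Jensen[OF ec, of "{1..t}" ?w "\<lambda>i. E i t"] t E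
    by (simp add: flh_weight_pos sum1[simplified] flh_prediction_def)
  then show "?p \<in> cube d 20" by simp
  assume i: "1 \<le> i" "i \<le> t"
  have w: "?w i > 0" using i by (rule flh_weight_pos)
  have t1: "1 - 1 / real (t + 1) = real t / real (t + 1)" by (simp add: field_simps)
  have "ln (flh_weight \<sigma> f E (Suc t) i) = ln (real t) - ln (real (t + 1)) + (ln (?w i) - \<sigma> * f t (E i t) - ln ?Z)"
    unfolding flh_weight_Suc[OF i] t1 using t Z w
    by (subst ln_mult_pos) (auto simp: ln_div ln_mult_pos simp del: of_nat_add of_nat_Suc)
  moreover have "ln ?Z \<le> - \<sigma> * f t ?p"
    using J Z by (metis ln_exp ln_le_cancel_iff exp_gt_zero)
  ultimately show "\<sigma> * (f t ?p - f t (E i t)) \<le>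
      ln (flh_weight \<sigma> f E (Suc t) i) - ln (?w i) + ln (real (t + 1)) - ln (real t)"
    by (simp add: algebra_simps)
qed

text \<open>The telescope starts at the birth of expert \<open>a\<close> with weight
  \<open>1 / a\<close>. The resulting \<open>ln a\<close> cancels against the newcomer costs, which
  sum to \<open>ln (b + 1) - ln a\<close>, and the last weight is at most 1.\<close>

lemma flh_regret:
  assumes sg: "\<sigma> > 0"
    and ec: "\<And>t. t \<in> {1..n} \<Longrightarrow> exp_concave_loss d \<sigma> (f t)"
    and E: "\<And>i t. 1 \<le> i \<Longrightarrow> i \<le> t \<Longrightarrow> t \<le> n \<Longrightarrow> E i t \<in> cube d 20"
    and ab: "1 \<le> a" "a \<le> b" "b \<le> n"
  shows "(\<Sum>t=a..b. f t (flh_prediction d \<sigma> f E t) - f t (E a t)) \<le> ln (real (b + 1)) / \<sigma>"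
proof -
  have "\<sigma> * (\<Sum>t=a..b. f t (flh_prediction d \<sigma> f E t) - f t (E a t))
      \<le> ln (flh_weight \<sigma> f E (Suc b) a) + ln (real (b + 1))"
    using ab(2,3)
  proof (induction b rule: dec_induct)
    case base
    have "ln (flh_weight \<sigma> f E a a) = - ln (real a)" using ab(1) by (simp add: flh_weight_new ln_div)
    then show ?case using flh_round(2)[of d \<sigma> f a E a] ec[of a] E ab(1) base by simp
  next
    case (step b)
    have "\<sigma> * (f (Suc b) (flh_prediction d \<sigma> f E (Suc b)) - f (Suc b) (E a (Suc b))) \<le>
      ln (flh_weight \<sigma> f E (Suc (Suc b)) a) - ln (flh_weight \<sigma> f E (Suc b) a) + ln (real (Suc b + 1)) - ln (real (Suc b))"
      using ec E ab(1) step by (intro flh_round(2)) auto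
    moreover have "(\<Sum>t=a..Suc b. h t) = (\<Sum>t=a..b. h t) + h (Suc b)" for h :: "nat \<Rightarrow> real"
      using step by simp
    ultimately show ?case using step by (simp add: distrib_left del: of_nat_Suc flh_weight.simps)
  qed
  moreover have "ln (flh_weight \<sigma> f E (Suc b) a) \<le> 0"
  proof -
    have "flh_weight \<sigma> f E (Suc b) a \<le> sum (flh_weight \<sigma> f E (Suc b)) {1..Suc b}"
      using ab by (intro member_le_sum) (use flh_weight_pos[of _ "Suc b" \<sigma> f E, THEN less_imp_le] in auto)
    also have "\<dots> = 1" by (rule flh_weight_sum) simp
    finally show ?thesis using flh_weight_pos[of a "Suc b" \<sigma> f E] ab by (subst ln_le_zero_iff) auto
  qed
  ultimately show ?thesis using sg by (simp add: field_simps)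
qed

text \<open>\<open>arg_min\<close> is a choice, so the existence of a minimizer comes first; the
  square root in \<open>mahalanobis\<close> is monotone and drops out.\<close>

lemma (in coercive_matrix) arg_min_projection:
  assumes u: "u \<in> carrier_vec m" and S: "S \<subseteq> carrier_vec m" "S \<noteq> {}"
    and conv: "\<And>x y \<theta>. x \<in> S \<Longrightarrow> y \<in> S \<Longrightarrow> 0 \<le> \<theta> \<Longrightarrow> \<theta> \<le> 1 \<Longrightarrow> x + \<theta> \<cdot>\<^sub>v (y - x) \<in> S"
    and closed: "coordinatewise_closed m S"
    and p: "p = arg_min (\<lambda>w. mahalanobis A (w - u)) (\<lambda>w. w \<in> S)"
  shows "p \<in> S" and "q \<in> S \<Longrightarrow> (p - q) \<bullet> (A *\<^sub>v (p - q)) \<le> (u - q) \<bullet> (A *\<^sub>v (u - q))"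
proof -
  have "\<exists>p'\<in>S. \<forall>q\<in>S. (p' - u) \<bullet> (A *\<^sub>v (p' - u)) \<le> (q - u) \<bullet> (A *\<^sub>v (q - u))"
  proof (rule projection_exists[OF u S])
    show "x + (1/2) \<cdot>\<^sub>v (y - x) \<in> S" if "x \<in> S" "y \<in> S" for x y using conv that by simp
  qed (rule closed)
  then obtain p' where "p' \<in> S" "\<forall>q\<in>S. (p' - u) \<bullet> (A *\<^sub>v (p' - u)) \<le> (q - u) \<bullet> (A *\<^sub>v (q - u))" ..
  then have "is_arg_min (\<lambda>w. mahalanobis A (w - u)) (\<lambda>w. w \<in> S) p'"
    by (auto simp: is_arg_min_def mahalanobis_def not_less)
  then have "is_arg_min (\<lambda>w. mahalanobis A (w - u)) (\<lambda>w. w \<in> S) p"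
    unfolding p arg_min_def by (rule someI)
  then have pS: "p \<in> S" and min: "\<And>q. q \<in> S \<Longrightarrow> (p - u) \<bullet> (A *\<^sub>v (p - u)) \<le> (q - u) \<bullet> (A *\<^sub>v (q - u))"
    by (auto simp: is_arg_min_def mahalanobis_def not_less)
  show "p \<in> S" by (rule pS)
  assume q: "q \<in> S"
  show "(p - q) \<bullet> (A *\<^sub>v (p - q)) \<le> (u - q) \<bullet> (A *\<^sub>v (u - q))"
  proof (rule minimizer_variational[OF u])
    show "(p - u) \<bullet> (A *\<^sub>v (p - u)) \<le> (p + \<theta> \<cdot>\<^sub>v (q - p) - u) \<bullet> (A *\<^sub>v (p + \<theta> \<cdot>\<^sub>v (q - p) - u))"
      if "0 < \<theta>" "\<theta> \<le> 1" for \<theta>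
      using that by (intro min conv[OF pS q]) auto
  qed (use pS q S in auto)
qed

section \<open>Feasibility and static regret of one SIONS expert\<close>

lemma decision_set_iff:
  "w \<in> decision_set d C j t \<longleftrightarrow> w \<in> carrier_vec (2 * d) \<and> linear_prediction d j t w \<in> cube d C"
  by (auto simp: decision_set_def cube_def linear_prediction_def)

lemma decision_set_convex:
  assumes "x \<in> decision_set d C j t" "y \<in> decision_set d C j t" "0 \<le> \<theta>" "\<theta> \<le> 1"
  shows "x + \<theta> \<cdot>\<^sub>v (y - x) \<in> decision_set d C j t"
proof -
  have c: "x \<in> carrier_vec (2 * d)" "y \<in> carrier_vec (2 * d)" using assms by (auto simp: decision_set_def)
  have "linear_prediction d j t (x + \<theta> \<cdot>\<^sub>v (y - x))
      = (1 - \<theta>) \<cdot>\<^sub>v linear_prediction d j t x + \<theta> \<cdot>\<^sub>v linear_prediction d j t y"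
    using c by (intro eq_vecI)
      (auto simp: linear_prediction_index linear_prediction_carrier[THEN carrier_vecD] algebra_simps)
  then show ?thesis using cube_convex_comb[of _ d C _ \<theta>] assms c by (simp add: decision_set_iff)
qed

lemma decision_set_closed: "coordinatewise_closed (2 * d) (decision_set d C j t)"
  unfolding coordinatewise_closed_def
proof (intro allI impI)
  fix w p
  assume w: "\<forall>k::nat. w k \<in> decision_set d C j t" and p: "p \<in> carrier_vec (2 * d)"
    and l: "\<forall>i<2 * d. (\<lambda>k. w k $ i) \<longlonglongrightarrow> p $ i"
  have "\<bar>covariate j t \<bullet> block p k\<bar> \<le> C" if k: "k < d" for k
  proof (rule LIMSEQ_le_const2)
    show "(\<lambda>i. \<bar>covariate j t \<bullet> block (w i) k\<bar>) \<longlonglongrightarrow> \<bar>covariate j t \<bullet> block p k\<bar>"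
      unfolding covariate_block using k by (intro tendsto_intros l[rule_format]) auto
  qed (use w k in \<open>auto simp: decision_set_def\<close>)
  then show "p \<in> decision_set d C j t" using p by (simp add: decision_set_def)
qed

lemma sions_matrix_gram:
  "sions_matrix d \<epsilon> \<eta> f j v t = regularized_gram (2 * d) \<epsilon> \<eta> (sions_gradient d f j v) j t"
  by (simp add: sions_matrix_def regularized_gram_def)

lemma sions_gradient_lift:
  assumes "gradient_lipschitz_loss d (f t)" "v t \<in> decision_set d 20 j t"
  shows "sions_gradient d f j v t = lift_gradient d j t (grad d (f t) (linear_prediction d j t (v t)))"
  unfolding sions_gradient_def using assms
  by (intro grad_eqI has_gradient_lifted_loss grad_has_gradient) (auto simp: decision_set_iff)

context
  fixes d n j :: nat and \<epsilon> \<sigma> :: real and f :: "nat \<Rightarrow> real vec \<Rightarrow> real" and v g :: "nat \<Rightarrow> real vec"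
    and A :: "nat \<Rightarrow> real mat"
  defines "v \<equiv> sions_iterate d \<epsilon> \<sigma> 20 f j"
    and "g \<equiv> sions_gradient d f j v"
    and "A \<equiv> regularized_gram (2 * d) \<epsilon> \<sigma> g j"
  assumes pos: "\<epsilon> > 0" "\<sigma> > 0" "j \<ge> 1"
    and loss: "\<And>t. 1 \<le> t \<Longrightarrow> t \<le> n \<Longrightarrow>
      lipschitz_loss d (f t) \<and> gradient_lipschitz_loss d (f t) \<and> exp_concave_loss d \<sigma> (f t)"
begin

text \<open>One strong induction, since the facts depend on each other: gradients are known only at
  feasible iterates, the matrix is coercive once all gradients so far are vectors of the right
  dimension, and the next iterate is feasible because projection for a coercive matrix
  exists.\<close>

lemma sions_projection:
  assumes "j \<le> t" "t \<le> n"
  shows "v t \<in> decision_set d 20 j t \<and> (t < n \<longrightarrow> v (Suc t) \<in> decision_set d 20 j (Suc t) \<and>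
    (\<forall>q\<in>decision_set d 20 j (Suc t). (v (Suc t) - q) \<bullet> (A t *\<^sub>v (v (Suc t) - q)) \<le>
      (v t - the (mat_inverse (A t)) *\<^sub>v g t - q) \<bullet>
        (A t *\<^sub>v (v t - the (mat_inverse (A t)) *\<^sub>v g t - q))))"
  using assms
proof (induction t rule: less_induct)
  case (less t)
  have vs: "v s \<in> decision_set d 20 j s" if s: "j \<le> s" "s \<le> t" for s
  proof (cases "s = j")
    case True
    have "0\<^sub>v (2 * d) \<in> decision_set d 20 j j"
      by (auto simp: decision_set_def covariate_block)
    then show ?thesis using True by (simp add: v_def sions_iterate_start)
  next
    case False
    then obtain s' where s': "s = Suc s'" "j \<le> s'" using s by (cases s) auto
    then show ?thesis using less.IH[of s'] s less.prems by auto
  qed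
  have gs: "g s \<in> carrier_vec (2 * d)" if "j \<le> s" "s \<le> t" for s
    unfolding g_def
    by (subst sions_gradient_lift) (use vs that less.prems loss[of s] pos in \<open>auto simp: lift_gradient_carrier\<close>)
  interpret coercive_matrix "2 * d" \<epsilon> "A t"
    unfolding A_def by (rule regularized_gram_coercive) (use gs pos in auto)
  define u where "u = v t - the (mat_inverse (A t)) *\<^sub>v g t"
  have u: "u \<in> carrier_vec (2 * d)"
    unfolding u_def using inverse_solves(1)[OF gs[of t]] vs[of t] less.prems
    by (auto simp: decision_set_def)
  have ne: "decision_set d 20 j (Suc t) \<noteq> {}"
  proof -
    have "0\<^sub>v (2 * d) \<in> decision_set d 20 j (Suc t)" by (auto simp: decision_set_def covariate_block)
    then show ?thesis by blast
  qed
  have vS: "v (Suc t) = arg_min (\<lambda>w. mahalanobis (A t) (w - u)) (\<lambda>w. w \<in> decision_set d 20 j (Suc t))"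
    using sions_iterate_Suc[OF less.prems(1), of d \<epsilon> \<sigma> 20 f]
    by (simp add: sions_step_def Let_def v_def u_def A_def g_def sions_matrix_gram)
  have sub: "decision_set d 20 j (Suc t) \<subseteq> carrier_vec (2 * d)" by (auto simp: decision_set_def)
  note P = arg_min_projection[OF u sub ne decision_set_convex decision_set_closed vS]
  show ?case using vs[of t] less.prems P unfolding u_def by auto
qed

lemma sions_prediction_cube:
  assumes "j \<le> t" "t \<le> n"
  shows "sions_prediction d \<epsilon> \<sigma> 20 f j t \<in> cube d 20"
  using sions_projection[OF assms] by (simp add: sions_prediction_def v_def decision_set_iff)

text \<open>Slope coordinates carry the factor \<open>t - j + 1 \<le> n\<close> on top of a partial
  derivative bounded by 1.\<close>

lemma sions_gradient_entry:
  assumes t: "j \<le> t" "t \<le> n" and i: "i < 2 * d"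
  shows "\<bar>g t $ i\<bar> \<le> real n"
proof -
  let ?x = "linear_prediction d j t (v t)"
  have x: "?x \<in> cube d 20" using sions_projection[OF t] by (simp add: decision_set_iff)
  have gl: "gradient_lipschitz_loss d (f t)" "lipschitz_loss d (f t)" using loss[of t] t pos by auto
  have e: "g t = lift_gradient d j t (grad d (f t) ?x)"
    unfolding g_def using sions_projection[OF t] gl by (intro sions_gradient_lift) auto
  have b: "\<bar>grad d (f t) ?x $ (i div 2)\<bar> \<le> 1"
    using gradient_coordinate_le[OF gl(2) grad_has_gradient[OF gl(1) x] x] i by simp
  have tau: "0 \<le> real t - real j + 1" "real t - real j + 1 \<le> real n" "1 \<le> real n" using t pos by auto
  have "\<bar>(real t - real j + 1) * grad d (f t) ?x $ (i div 2)\<bar> \<le> real n * 1"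
    unfolding abs_mult using b tau by (intro mult_mono) auto
  then show ?thesis using b tau i by (auto simp: e lift_gradient_def)
qed

text \<open>The matrix is built with the exp-concavity factor \<open>\<sigma>\<close> itself, so the
  squares subtracted by the quadratic lower bound of the losses cancel exactly those added by the
  Newton analysis. There remain the initial distance, which is \<open>q \<bullet> q\<close> as the
  expert starts at 0, and the determinant potential.\<close>

lemma sions_static_regret:
  assumes b: "j \<le> b" "b \<le> n" and q: "q \<in> carrier_vec (2 * d)"
    and lq: "\<And>t. j \<le> t \<Longrightarrow> t \<le> b \<Longrightarrow> linear_prediction d j t q \<in> cube d 20"
  shows "2 * (\<Sum>t=j..b. f t (sions_prediction d \<epsilon> \<sigma> 20 f j t) - f t (linear_prediction d j t q))
    \<le> \<epsilon> * (q \<bullet> q) + (ln (det (A b)) - 2 * d * ln \<epsilon>) / \<sigma>" and "det (A b) > 0"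
proof -
  define z where "z t = the (mat_inverse (A t)) *\<^sub>v g t" for t
  have vt: "v t \<in> decision_set d 20 j t" if "j \<le> t" "t \<le> b" for t
    using sions_projection[of t] that b by simp
  have loss': "lipschitz_loss d (f t)" "gradient_lipschitz_loss d (f t)" "exp_concave_loss d \<sigma> (f t)"
    if "j \<le> t" "t \<le> b" for t using loss[of t] that b pos by auto
  have gl: "g t = lift_gradient d j t (grad d (f t) (linear_prediction d j t (v t)))" if "j \<le> t" "t \<le> b" for t
    unfolding g_def using vt[OF that] loss'[OF that] by (intro sions_gradient_lift)
  have gc: "g t \<in> carrier_vec (2 * d)" if "j \<le> t" "t \<le> b" for t
    using gl[OF that] by (simp add: lift_gradient_carrier)
  have cA: "coercive_matrix (2 * d) \<epsilon> (A t)" if "j \<le> t" "t \<le> b" for t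
    unfolding A_def by (rule regularized_gram_coercive) (use gc that pos in auto)
  have zc: "z t \<in> carrier_vec (2 * d)" "A t *\<^sub>v z t = g t" if "j \<le> t" "t \<le> b" for t
    unfolding z_def using coercive_matrix.inverse_solves[OF cA[OF that] gc[OF that]] by auto
  have vc: "v t \<in> carrier_vec (2 * d)" if "j \<le> t" "t \<le> b" for t
    using vt[OF that] by (simp add: decision_set_def)
  have N: "2 * (\<Sum>s=j..b. g s \<bullet> (v s - q)) + (v b - z b - q) \<bullet> (A b *\<^sub>v (v b - z b - q))
    \<le> (\<Sum>s=j..b. g s \<bullet> z s) + \<sigma> * (\<Sum>s=j..b. (g s \<bullet> (v s - q))\<^sup>2) + \<epsilon> * ((v j - q) \<bullet> (v j - q))"
    unfolding A_def
  \<comment> \<open>The horizon is \<open>b\<close> rather than \<open>n\<close>, because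
    \<open>q\<close> is assumed feasible up to round \<open>b\<close> only.\<close>
  proof (rule newton_step_regret[where n = b])
    fix s assume s: "j \<le> s" "s < b"
    have "q \<in> decision_set d 20 j (Suc s)" using q lq[of "Suc s"] s by (simp add: decision_set_iff)
    then show "(v (Suc s) - q) \<bullet> (regularized_gram (2 * d) \<epsilon> \<sigma> g j s *\<^sub>v (v (Suc s) - q))
      \<le> (v s - z s - q) \<bullet> (regularized_gram (2 * d) \<epsilon> \<sigma> g j s *\<^sub>v (v s - z s - q))"
      using sions_projection[of s] s b unfolding z_def A_def by auto
  qed (use gc zc vc pos q b A_def in auto)
  have D: "det (A b) > 0 \<and> \<sigma> * (\<Sum>s=j..b. g s \<bullet> z s) \<le> ln (det (A b)) - real (2 * d) * ln \<epsilon>"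
    unfolding A_def by (rule log_det_potential[where n = b]) (use gc zc pos b A_def in auto)
  then show "det (A b) > 0" by simp
  have nn: "(v b - z b - q) \<bullet> (A b *\<^sub>v (v b - z b - q)) \<ge> 0"
    using coercive_matrix.quad_nonneg[OF cA[of b], of "v b - z b - q"] vc[of b] zc[of b] q b by simp
  have vj: "(v j - q) \<bullet> (v j - q) = q \<bullet> q"
  proof -
    have "v j = 0\<^sub>v (2 * d)" by (simp add: v_def sions_iterate_start)
    then show ?thesis using q by (simp add: scalar_prod_lessThan[of _ "2 * d"])
  qed
  have round: "f t (sions_prediction d \<epsilon> \<sigma> 20 f j t) - f t (linear_prediction d j t q)
      \<le> g t \<bullet> (v t - q) - \<sigma> / 2 * (g t \<bullet> (v t - q))\<^sup>2" if t: "j \<le> t" "t \<le> b" for t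
  proof -
    let ?x = "linear_prediction d j t (v t)" and ?y = "linear_prediction d j t q"
    let ?G = "grad d (f t) ?x"
    have x: "?x \<in> cube d 20" using vt[OF t] by (simp add: decision_set_iff)
    have "f t ?y \<ge> f t ?x + ?G \<bullet> (?y - ?x) + \<sigma> / 2 * (?G \<bullet> (?y - ?x))\<^sup>2"
      using loss'(3)[OF t] x lq[OF t] unfolding exp_concave_loss_def by blast
    moreover have "?G \<bullet> (?y - ?x) = g t \<bullet> (q - v t)"
      using q vc[OF t] by (simp add: gl[OF t] lift_gradient_scalar_prod linear_prediction_minus)
    moreover have "g t \<bullet> (q - v t) = - (g t \<bullet> (v t - q))"
      using q vc[OF t] gc[OF t] by (simp add: scalar_prod_minus_distrib[of _ "2 * d"])
    ultimately show ?thesis by (simp add: sions_prediction_def v_def)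
  qed
  have "2 * (\<Sum>t=j..b. f t (sions_prediction d \<epsilon> \<sigma> 20 f j t) - f t (linear_prediction d j t q))
    \<le> 2 * (\<Sum>t=j..b. g t \<bullet> (v t - q) - \<sigma> / 2 * (g t \<bullet> (v t - q))\<^sup>2)"
    using round by (intro mult_left_mono sum_mono) auto
  also have "\<dots> = 2 * (\<Sum>t=j..b. g t \<bullet> (v t - q)) - \<sigma> * (\<Sum>t=j..b. (g t \<bullet> (v t - q))\<^sup>2)"
    by (simp add: sum_subtractf sum_distrib_left)
  also have "\<dots> \<le> (\<Sum>s=j..b. g s \<bullet> z s) + \<epsilon> * (q \<bullet> q)" using N nn vj by simp
  also have "(\<Sum>s=j..b. g s \<bullet> z s) \<le> (ln (det (A b)) - 2 * d * ln \<epsilon>) / \<sigma>"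
    using D pos by (simp add: field_simps)
  finally show "2 * (\<Sum>t=j..b. f t (sions_prediction d \<epsilon> \<sigma> 20 f j t) - f t (linear_prediction d j t q))
    \<le> \<epsilon> * (q \<bullet> q) + (ln (det (A b)) - 2 * d * ln \<epsilon>) / \<sigma>" by simp
qed

text \<open>An entry of the Gram sum consists of at most \<open>n\<close> products of two numbers
  bounded by \<open>n\<close>, hence \<open>n ^ 3\<close>.\<close>

lemma sions_log_det:
  assumes b: "j \<le> b" "b \<le> n" and d: "d \<ge> 1" and det: "det (A b) > 0"
  shows "ln (det (A b)) \<le> 2 * d * (2 * d + ln (\<epsilon> + \<sigma>) + 3 * ln n)"
proof -
  have n: "n \<ge> 1" using b pos by simp
  have "\<bar>A b $$ (i, k)\<bar> \<le> (\<epsilon> + \<sigma>) * real n ^ 3" if ik: "i < 2 * d" "k < 2 * d" for i k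
  proof -
    have "\<bar>\<Sum>s=j..b. g s $ i * g s $ k\<bar> \<le> (\<Sum>s=j..b. real n * real n)"
      using sions_gradient_entry ik b
      by (intro order.trans[OF sum_abs] sum_mono) (auto simp: abs_mult intro!: mult_mono)
    also have "\<dots> = real (Suc b - j) * (real n * real n)" by simp
    also have "\<dots> \<le> real n * (real n * real n)"
      using b pos by (intro mult_right_mono) auto
    finally have s: "\<bar>\<Sum>s=j..b. g s $ i * g s $ k\<bar> \<le> real n ^ 3" by (simp add: power3_eq_cube)
    have "\<bar>A b $$ (i, k)\<bar> \<le> \<epsilon> + \<bar>\<sigma> * (\<Sum>s=j..b. g s $ i * g s $ k)\<bar>"
      using ik pos by (auto simp: A_def regularized_gram_def intro!: order.trans[OF abs_triangle_ineq])
    also have "\<dots> \<le> \<epsilon> * real n ^ 3 + \<sigma> * real n ^ 3"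
      unfolding abs_mult using s pos n by (intro add_mono mult_mono) auto
    finally show ?thesis by (simp add: algebra_simps)
  qed
  then have "det (A b) \<le> (real (2 * d) * ((\<epsilon> + \<sigma>) * real n ^ 3)) ^ (2 * d)"
    by (intro det_le_entry_bound) (auto simp: A_def regularized_gram_carrier)
  then have "ln (det (A b)) \<le> ln ((real (2 * d) * ((\<epsilon> + \<sigma>) * real n ^ 3)) ^ (2 * d))"
    using det by (intro ln_mono) auto
  also have "\<dots> = 2 * d * (ln (2 * d) + ln (\<epsilon> + \<sigma>) + 3 * ln n)"
    using d n pos by (simp add: ln_realpow ln_mult_pos)
  \<comment> \<open>\<open>ln (2 * d)\<close> cannot be hidden among the logarithms of
    \<open>n\<close>; it is absorbed by a second factor \<open>d\<close>.\<close>
  also have "\<dots> \<le> 2 * d * (2 * d + ln (\<epsilon> + \<sigma>) + 3 * ln n)"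
    using d ln_le_minus_one[of "2 * real d"] by (intro mult_left_mono add_mono) auto
  finally show ?thesis .
qed

end

section \<open>Randomised comparators\<close>

text \<open>A stand-in for the expectation over a uniform offset in [0, 1): all functions that occur are
  combinations of shifted floors, for which this limit exists by Hermite's identity.\<close>
definition equispaced_mean :: "(real \<Rightarrow> real) \<Rightarrow> real \<Rightarrow> bool" where
  "equispaced_mean h m \<longleftrightarrow> (\<lambda>N. (\<Sum>i<N. h (real i / real N)) / real N) \<longlonglongrightarrow> m"

lemma equispaced_mean_const: "equispaced_mean (\<lambda>u. c) c"
proof -
  have "\<forall>\<^sub>F N in sequentially. (\<Sum>i<N. c) / real N = c"
    by (rule eventually_sequentiallyI[of 1]) auto
  then show ?thesis unfolding equispaced_mean_def by (rule tendsto_eventually)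
qed

lemma equispaced_mean_add:
  assumes "equispaced_mean g a" "equispaced_mean h b"
  shows "equispaced_mean (\<lambda>u. g u + h u) (a + b)"
  using tendsto_add[OF assms[unfolded equispaced_mean_def]]
  by (simp add: equispaced_mean_def sum.distrib add_divide_distrib)

lemma equispaced_mean_cmult:
  assumes "equispaced_mean h a"
  shows "equispaced_mean (\<lambda>u. c * h u) (c * a)"
  using tendsto_mult_left[OF assms[unfolded equispaced_mean_def], of c]
  by (simp add: equispaced_mean_def sum_distrib_left)

lemma equispaced_mean_sum:
  assumes "\<And>i. i \<in> I \<Longrightarrow> equispaced_mean (h i) (a i)"
  shows "equispaced_mean (\<lambda>u. \<Sum>i\<in>I. h i u) (\<Sum>i\<in>I. a i)"
  using assms
proof (induction I rule: infinite_finite_induct)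
  case (insert i I)
  then show ?case using equispaced_mean_add[of "h i" "a i" "\<lambda>u. \<Sum>i\<in>I. h i u"] by simp
qed (simp_all add: equispaced_mean_const)

lemma equispaced_mean_le:
  assumes "equispaced_mean h a" "equispaced_mean g b"
    and "\<And>u. 0 \<le> u \<Longrightarrow> u < 1 \<Longrightarrow> h u \<le> g u"
  shows "a \<le> b"
proof (rule LIMSEQ_le)
  show "\<exists>N0. \<forall>N\<ge>N0. (\<Sum>i<N. h (real i / real N)) / real N \<le> (\<Sum>i<N. g (real i / real N)) / real N"
    by (intro exI[of _ 1] allI impI divide_right_mono sum_mono assms(3)) auto
qed (use assms in \<open>auto simp: equispaced_mean_def\<close>)

text \<open>Raising \<open>m\<close> by one shifts the summands by one place; the telescope leaves
  \<open>(m + N) div N - m div N = 1\<close>.\<close>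

lemma sum_div_shifts:
  assumes "N > 0"
  shows "(\<Sum>i<N. (m + int i) div int N) = m"
proof (induction m rule: int_induct[where k = 0])
  case base
  then show ?case by simp
next
  case (step1 m)
  have "(\<Sum>i<N. (m + 1 + int i) div int N) - (\<Sum>i<N. (m + int i) div int N)
      = (\<Sum>i<N. (m + int (Suc i)) div int N - (m + int i) div int N)"
    by (simp add: sum_subtractf algebra_simps)
  also have "\<dots> = 1" using assms by (subst sum_lessThan_telescope) simp
  finally show ?case using step1 by simp
next
  case (step2 m)
  have "(\<Sum>i<N. (m + int i) div int N) - (\<Sum>i<N. (m - 1 + int i) div int N)
      = (\<Sum>i<N. (m - 1 + int (Suc i)) div int N - (m - 1 + int i) div int N)"
    by (simp add: sum_subtractf algebra_simps)
  also have "\<dots> = 1" using assms by (subst sum_lessThan_telescope) simp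
  finally show ?case using step2 by simp
qed

lemma Hermite_identity:
  assumes "N > 0"
  shows "(\<Sum>i<N. \<lfloor>x + real i / real N\<rfloor>) = \<lfloor>real N * x\<rfloor>"
proof -
  have "\<lfloor>x + real i / real N\<rfloor> = (\<lfloor>real N * x\<rfloor> + int i) div int N" for i
  proof -
    have "x + real i / real N = (real N * x + real i) / real_of_int (int N)"
      using assms by (simp add: field_simps)
    also have "\<lfloor>\<dots>\<rfloor> = \<lfloor>real N * x + real i\<rfloor> div int N" by (rule floor_divide_real_eq_div) simp
    finally show ?thesis by simp
  qed
  then show ?thesis using sum_div_shifts[OF assms] by simp
qed

text \<open>By Hermite's identity the average over \<open>N\<close> nodes is
  \<open>\<lfloor>N * x\<rfloor> / N\<close>, which is within \<open>1 / N\<close> of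
  \<open>x\<close>.\<close>

lemma equispaced_mean_floor: "equispaced_mean (\<lambda>u. real_of_int \<lfloor>x + u\<rfloor>) x"
  unfolding equispaced_mean_def
proof (rule LIMSEQ_I)
  fix e :: real assume "e > 0"
  then obtain M where M: "inverse (real (Suc M)) < e" using reals_Archimedean by blast
  have "norm ((\<Sum>i<N. real_of_int \<lfloor>x + real i / real N\<rfloor>) / real N - x) < e" if "N \<ge> Suc M" for N
  proof -
    have N: "N > 0" using that by simp
    have s: "(\<Sum>i<N. real_of_int \<lfloor>x + real i / real N\<rfloor>) = real_of_int \<lfloor>real N * x\<rfloor>"
      using Hermite_identity[OF N, of x] by (metis of_int_sum)
    have "\<bar>real_of_int \<lfloor>real N * x\<rfloor> - real N * x\<bar> \<le> 1" by linarith
    then have "\<bar>(real_of_int \<lfloor>real N * x\<rfloor> - real N * x) / real N\<bar> \<le> 1 / real N"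
      unfolding abs_divide using N by (simp add: divide_right_mono)
    also have "1 / real N \<le> inverse (real (Suc M))" using that N
      by (simp add: inverse_eq_divide frac_le del: of_nat_Suc)
    finally show ?thesis unfolding s using M N by (simp add: diff_divide_distrib)
  qed
  then show "\<exists>N0. \<forall>N\<ge>N0. norm ((\<Sum>i<N. real_of_int \<lfloor>x + real i / real N\<rfloor>) / real N - x) < e" by blast
qed

text \<open>A common shift preserves the order, so the absolute value is a difference of two floors
  with constant sign and the mean is linear in it.\<close>

lemma equispaced_mean_floor_diff:
  "equispaced_mean (\<lambda>u. \<bar>real_of_int \<lfloor>x + u\<rfloor> - real_of_int \<lfloor>y + u\<rfloor>\<bar>) \<bar>x - y\<bar>"
proof -
  have *: "equispaced_mean (\<lambda>u. \<bar>real_of_int \<lfloor>x + u\<rfloor> - real_of_int \<lfloor>y + u\<rfloor>\<bar>) \<bar>x - y\<bar>" if "y \<le> x" for x y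
  proof -
    have "\<bar>real_of_int \<lfloor>x + u\<rfloor> - real_of_int \<lfloor>y + u\<rfloor>\<bar>
        = real_of_int \<lfloor>x + u\<rfloor> + (-1) * real_of_int \<lfloor>y + u\<rfloor>" for u
      using floor_mono[of "y + u" "x + u"] that by simp
    moreover have "equispaced_mean (\<lambda>u. real_of_int \<lfloor>x + u\<rfloor> + (-1) * real_of_int \<lfloor>y + u\<rfloor>) (x + (-1) * y)"
      by (intro equispaced_mean_add equispaced_mean_cmult equispaced_mean_floor)
    ultimately show ?thesis using that by simp
  qed
  show ?thesis
  proof (cases "y \<le> x")
    case False
    then show ?thesis using *[of x y] by (simp add: abs_minus_commute)
  qed (rule *)
qed

text \<open>Dithered rounding to the grid of width \<open>\<delta>\<close>: unbiased for a uniform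
  offset \<open>u\<close>.\<close>

definition round_to :: "real \<Rightarrow> real \<Rightarrow> real \<Rightarrow> real" where
  "round_to \<delta> u x = \<delta> * real_of_int \<lfloor>x / \<delta> + u\<rfloor>"

lemma equispaced_mean_round_to: "\<delta> > 0 \<Longrightarrow> equispaced_mean (\<lambda>u. round_to \<delta> u x) x"
  unfolding round_to_def using equispaced_mean_cmult[OF equispaced_mean_floor, of \<delta> "x / \<delta>"] by simp

lemma round_to_error:
  assumes "\<delta> > 0" "0 \<le> u" "u < 1"
  shows "\<bar>round_to \<delta> u x - x\<bar> \<le> \<delta>"
proof -
  have "\<bar>real_of_int \<lfloor>x / \<delta> + u\<rfloor> - x / \<delta>\<bar> \<le> 1" using assms by linarith
  then have "\<delta> * \<bar>real_of_int \<lfloor>x / \<delta> + u\<rfloor> - x / \<delta>\<bar> \<le> \<delta> * 1"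
    using assms by (intro mult_left_mono) auto
  moreover have "round_to \<delta> u x - x = \<delta> * (real_of_int \<lfloor>x / \<delta> + u\<rfloor> - x / \<delta>)"
    using assms by (simp add: round_to_def right_diff_distrib)
  ultimately show ?thesis using assms by (simp add: abs_mult)
qed

text \<open>Peel off the last run, which starts at the largest break; one exists because 1 is in
  \<open>B\<close>.\<close>

lemma sum_le_card_breaks:
  fixes r :: "nat \<Rightarrow> real" and R :: real
  assumes run: "\<And>a b. 1 \<le> a \<Longrightarrow> a \<le> b \<Longrightarrow> b \<le> n \<Longrightarrow> {a<..b} \<inter> B = {} \<Longrightarrow> (\<Sum>t=a..b. r t) \<le> R"
    and B: "1 \<in> B" "B \<subseteq> {1..n}"
  shows "(\<Sum>t=1..n. r t) \<le> real (card B) * R"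
proof -
  have "(\<Sum>t=1..m. r t) \<le> real (card (B \<inter> {1..m})) * R" if "m \<le> n" for m
    using that
  proof (induction m rule: less_induct)
    case (less m)
    show ?case
    proof (cases "m = 0")
      case False
      define a where "a = Max (B \<inter> {1..m})"
      have fin: "finite (B \<inter> {1..m})" by simp
      have ne: "B \<inter> {1..m} \<noteq> {}" using B(1) False by auto
      have a: "a \<in> B" "1 \<le> a" "a \<le> m" using Max_in[OF fin ne] by (auto simp: a_def)
      have le: "x \<le> a" if "x \<in> B" "x \<le> m" for x
        using Max_ge[OF fin, of x] that B(2) by (auto simp: a_def)
      then have gap: "{a<..m} \<inter> B = {}" by force
      have "B \<inter> {1..m} = insert a (B \<inter> {1..a - 1})" using le a by force
      then have "card (B \<inter> {1..m}) = Suc (card (B \<inter> {1..a - 1}))"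
        using a by (simp add: card_insert_if)
      moreover have "(\<Sum>t=1..m. r t) = (\<Sum>t=1..a - 1. r t) + (\<Sum>t=a..m. r t)"
        using sum.ub_add_nat[of 1 "a - 1" r "m - (a - 1)"] a by simp
      moreover have "(\<Sum>t=1..a - 1. r t) \<le> real (card (B \<inter> {1..a - 1})) * R"
        using less a by (intro less.IH) auto
      moreover have "(\<Sum>t=a..m. r t) \<le> R" using a gap less.prems by (intro run) auto
      ultimately show ?thesis by (simp add: distrib_right)
    qed simp
  qed
  from this[of n] show ?thesis using B(2) by (simp add: Int_absorb2)
qed

text \<open>Distinct integers are at least 1 apart. The right-hand side, unlike a count of changes,
  has a computable mean when the integers are shifted floors.\<close>

lemma card_changes_le:
  fixes a b :: "nat \<Rightarrow> nat \<Rightarrow> int"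
  assumes "finite T"
  shows "real (card {t \<in> T. \<exists>k<d. a t k \<noteq> b t k}) \<le> (\<Sum>t\<in>T. \<Sum>k<d. \<bar>real_of_int (a t k) - real_of_int (b t k)\<bar>)"
proof -
  have "real (card {t \<in> T. \<exists>k<d. a t k \<noteq> b t k}) = (\<Sum>t\<in>{t \<in> T. \<exists>k<d. a t k \<noteq> b t k}. 1)" by simp
  also have "\<dots> \<le> (\<Sum>t\<in>{t \<in> T. \<exists>k<d. a t k \<noteq> b t k}. \<Sum>k<d. \<bar>real_of_int (a t k) - real_of_int (b t k)\<bar>)"
  proof (rule sum_mono)
    fix t assume "t \<in> {t \<in> T. \<exists>k<d. a t k \<noteq> b t k}"
    then obtain k where k: "k < d" "a t k \<noteq> b t k" by auto
    have "1 \<le> \<bar>real_of_int (a t k) - real_of_int (b t k)\<bar>" using k(2) by linarith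
    also have "\<dots> \<le> (\<Sum>k<d. \<bar>real_of_int (a t k) - real_of_int (b t k)\<bar>)"
      using k(1) by (intro member_le_sum) auto
    finally show "1 \<le> (\<Sum>k<d. \<bar>real_of_int (a t k) - real_of_int (b t k)\<bar>)" .
  qed
  also have "\<dots> \<le> (\<Sum>t\<in>T. \<Sum>k<d. \<bar>real_of_int (a t k) - real_of_int (b t k)\<bar>)"
    using assms by (intro sum_mono2) (auto intro: sum_nonneg)
  finally show ?thesis .
qed

text \<open>The cost of one run: the FLH term, half of \<open>\<epsilon> * (q \<bullet> q)\<close>
  with \<open>\<epsilon> = 2\<close> and \<open>q \<bullet> q \<le> 72 * d\<close>, and half of the
  log-determinant bound over \<open>\<sigma>\<close>.\<close>

definition run_regret :: "real \<Rightarrow> nat \<Rightarrow> nat \<Rightarrow> real" where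
  "run_regret \<sigma> d n = ln (real (n + 1)) / \<sigma> + 72 * d + d * (2 * d + ln (2 + \<sigma>) + 3 * ln n) / \<sigma>"

lemma run_regret_nonneg:
  assumes "\<sigma> > 0" "n \<ge> 1"
  shows "run_regret \<sigma> d n \<ge> 0"
  unfolding run_regret_def using assms
  by (intro add_nonneg_nonneg divide_nonneg_pos mult_nonneg_nonneg) auto

lemma run_regret_le:
  assumes sg: "\<sigma> > 0" and d: "d \<ge> 1" and n: "n \<ge> 1"
  shows "run_regret \<sigma> d n \<le> (real d)\<^sup>2 * (1 + ln n) * (7 / \<sigma> + 73)"
proof -
  define l where "l = 1 + ln (real n)"
  have l: "l \<ge> 1" using n by (simp add: l_def)
  have d1: "real d \<ge> 1" using d by simp
  have dl: "1 \<le> d * l" using mult_mono[OF d1 l] by simp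
  have ddl: "d * l \<le> (real d)\<^sup>2 * l" using d1 l by (simp add: power2_eq_square mult_right_mono)
  have "ln (real (n + 1)) \<le> ln (2 * real n)" using n by (intro ln_mono) auto
  also have "\<dots> \<le> l" using n ln_2_less_1 by (simp add: l_def ln_mult_pos)
  also have "l \<le> (real d)\<^sup>2 * l" using l d1 by (simp add: mult_le_cancel_right1 one_le_power)
  finally have 1: "ln (real (n + 1)) \<le> (real d)\<^sup>2 * l" .
  have 2: "real d \<le> (real d)\<^sup>2 * l"
    using ddl l d1 by (intro order.trans[OF _ ddl]) (simp add: mult_le_cancel_left1)
  have "ln (2 + \<sigma>) \<le> 1 + \<sigma>" using ln_le_minus_one[of "2 + \<sigma>"] sg by simp
  then have "2 * d + ln (2 + \<sigma>) + 3 * ln n \<le> 2 * d + (1 + \<sigma>) * 1 + 3 * l" by (simp add: l_def)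
  also have "\<dots> \<le> 2 * (d * l) + (1 + \<sigma>) * (d * l) + 3 * (d * l)"
    using dl l d1 sg by (intro add_mono mult_left_mono) (auto simp: mult_le_cancel_left1 mult_le_cancel_right1)
  finally have "d * (2 * d + ln (2 + \<sigma>) + 3 * ln n) \<le> d * ((6 + \<sigma>) * (d * l))"
    by (intro mult_left_mono) (auto simp: algebra_simps)
  then have 3: "d * (2 * d + ln (2 + \<sigma>) + 3 * ln n) \<le> (6 + \<sigma>) * ((real d)\<^sup>2 * l)"
    by (simp add: power2_eq_square mult_ac)
  \<comment> \<open>The terms contribute \<open>1 / \<sigma>\<close>, 72 and
    \<open>(6 + \<sigma>) / \<sigma>\<close>, in total \<open>7 / \<sigma> + 73\<close>.\<close>
  have "run_regret \<sigma> d n \<le> ((real d)\<^sup>2 * l) / \<sigma> + 72 * ((real d)\<^sup>2 * l) + (6 + \<sigma>) * ((real d)\<^sup>2 * l) / \<sigma>"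
    unfolding run_regret_def using 1 2 3 sg by (intro add_mono divide_right_mono) auto
  also have "\<dots> = (real d)\<^sup>2 * l * (7 / \<sigma> + 73)" using sg by (simp add: field_simps)
  finally show ?thesis by (simp add: l_def)
qed

section \<open>Regret against piecewise affine and against randomised comparators\<close>

context
  fixes d n :: nat and \<sigma> :: real and f :: "nat \<Rightarrow> real vec \<Rightarrow> real"
  assumes d: "d \<ge> 1" and sg: "\<sigma> > 0"
    and loss: "\<And>t. 1 \<le> t \<Longrightarrow> t \<le> n \<Longrightarrow>
      lipschitz_loss d (f t) \<and> gradient_lipschitz_loss d (f t) \<and> exp_concave_loss d \<sigma> (f t)"
begin

lemma expert_cube:
  "1 \<le> j \<Longrightarrow> j \<le> t \<Longrightarrow> t \<le> n \<Longrightarrow> sions_prediction d 2 \<sigma> 20 f j t \<in> cube d 20"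
  by (rule sions_prediction_cube[where n = n]) (use sg loss in auto)

lemma flh_sions_cube: "1 \<le> t \<Longrightarrow> t \<le> n \<Longrightarrow> flh_sions d \<sigma> 2 20 f t \<in> cube d 20"
  unfolding flh_sions_def by (rule flh_round(1)) (use loss expert_cube in auto)

text \<open>Affine sequences are what a fixed parameter vector of the expert born at
  \<open>a\<close> predicts. Values within 2 give slopes within 4 and intercepts within 6, so the
  vector has small norm and its predictions lie well inside the cube.\<close>

lemma affine_run_regret:
  assumes ab: "1 \<le> a" "a \<le> b" "b \<le> n"
    and aff: "\<And>t k. a \<le> t \<Longrightarrow> t \<le> b \<Longrightarrow> k < d \<Longrightarrow> u t k = u a k + real (t - a) * \<beta> k"
    and bd: "\<And>t k. a \<le> t \<Longrightarrow> t \<le> b \<Longrightarrow> k < d \<Longrightarrow> \<bar>u t k\<bar> \<le> 2"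
  shows "(\<Sum>t=a..b. f t (flh_sions d \<sigma> 2 20 f t) - f t (vec d (u t))) \<le> run_regret \<sigma> d n"
proof -
  \<comment> \<open>On a run of a single round \<open>\<beta>\<close> is unconstrained and would
    spoil the norm bound.\<close>
  define \<gamma> where "\<gamma> k = (if a = b then 0 else \<beta> k)" for k
  have aff': "u t k = u a k + real (t - a) * \<gamma> k" if "a \<le> t" "t \<le> b" "k < d" for t k
    using aff[OF that] that by (auto simp: \<gamma>_def)
  have g4: "\<bar>\<gamma> k\<bar> \<le> 4" if k: "k < d" for k
  proof (cases "a = b")
    case False
    then show ?thesis using aff'[of "a + 1" k] bd[of a k] bd[of "a + 1" k] ab k by auto
  qed (simp add: \<gamma>_def)
  \<comment> \<open>The covariate counts from 1 at round \<open>a\<close>, so the intercept is the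
    affine continuation to the round before \<open>a\<close>.\<close>
  define q where "q = vec (2 * d) (\<lambda>i. if even i then u a (i div 2) - \<gamma> (i div 2) else \<gamma> (i div 2))"
  have q: "q \<in> carrier_vec (2 * d)" by (simp add: q_def)
  have lq: "linear_prediction d a t q = vec d (u t)" if "a \<le> t" "t \<le> b" for t
    using aff'[OF that] that by (intro eq_vecI) (auto simp: linear_prediction_index q_def linear_prediction_carrier[THEN carrier_vecD] of_nat_diff algebra_simps)
  have uc: "vec d (u t) \<in> cube d 20" if "a \<le> t" "t \<le> b" for t
    using bd[OF that] by (force simp: cube_def)
  have "\<bar>q $ i\<bar> \<le> 6" if "i < 2 * d" for i
  proof -
    have "i div 2 < d" using that by linarith
    then show ?thesis using that g4[of "i div 2"] bd[of a "i div 2"] ab by (auto simp: q_def)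
  qed
  then have "q \<bullet> q \<le> (6 * sqrt (2 * d))\<^sup>2"
    using l2norm_le_sqrt[OF q, of 6] by (subst l2norm_square[symmetric]) (intro power_mono, auto simp: l2norm_nonneg)
  then have qq: "q \<bullet> q \<le> 72 * d" by (simp add: power_mult_distrib)
  have E: "2 * (\<Sum>t=a..b. f t (sions_prediction d 2 \<sigma> 20 f a t) - f t (vec d (u t)))
      \<le> 2 * (72 * d) + 2 * d * (2 * d + ln (2 + \<sigma>) + 3 * ln n) / \<sigma>"
  proof -
    let ?A = "regularized_gram (2 * d) 2 \<sigma> (sions_gradient d f a (sions_iterate d 2 \<sigma> 20 f a)) a"
    have lq': "linear_prediction d a t q \<in> cube d 20" if "a \<le> t" "t \<le> b" for t
      using lq[OF that] uc[OF that] by simp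
    note S = sions_static_regret[where \<epsilon> = 2 and \<sigma> = \<sigma> and j = a and n = n and d = d and f = f and b = b and q = q]
    have "2 * (\<Sum>t=a..b. f t (sions_prediction d 2 \<sigma> 20 f a t) - f t (linear_prediction d a t q))
      \<le> 2 * (q \<bullet> q) + (ln (det (?A b)) - real (2 * d) * ln 2) / \<sigma>" and det: "det (?A b) > 0"
      using S sg ab loss q lq' by auto
    moreover have "ln (det (?A b)) \<le> 2 * d * (2 * d + ln (2 + \<sigma>) + 3 * ln n)"
      by (rule sions_log_det[where n = n]) (use sg ab loss det d in auto)
    \<comment> \<open>The subtracted multiple of \<open>ln 2\<close>, coming from
      \<open>\<epsilon> = 2\<close>, is nonnegative and is dropped.\<close>
    then have "(ln (det (?A b)) - real (2 * d) * ln 2) / \<sigma> \<le> 2 * d * (2 * d + ln (2 + \<sigma>) + 3 * ln n) / \<sigma>"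
      using sg by (intro divide_right_mono) (auto intro: order.trans[rotated])
    ultimately have "2 * (\<Sum>t=a..b. f t (sions_prediction d 2 \<sigma> 20 f a t) - f t (linear_prediction d a t q))
      \<le> 2 * (72 * d) + 2 * d * (2 * d + ln (2 + \<sigma>) + 3 * ln n) / \<sigma>"
      using qq by linarith
    also have "(\<Sum>t=a..b. f t (sions_prediction d 2 \<sigma> 20 f a t) - f t (linear_prediction d a t q))
        = (\<Sum>t=a..b. f t (sions_prediction d 2 \<sigma> 20 f a t) - f t (vec d (u t)))"
      by (intro sum.cong) (auto simp: lq)
    finally show ?thesis .
  qed
  have F: "(\<Sum>t=a..b. f t (flh_sions d \<sigma> 2 20 f t) - f t (sions_prediction d 2 \<sigma> 20 f a t)) \<le> ln (real (b + 1)) / \<sigma>"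
    unfolding flh_sions_def by (rule flh_regret[where n = n]) (use sg loss expert_cube ab in auto)
  also have "\<dots> \<le> ln (real (n + 1)) / \<sigma>" using ab sg by (intro divide_right_mono ln_mono) auto
  finally show ?thesis using E by (simp add: run_regret_def sum_subtractf)
qed

text \<open>\<open>v t\<close> is the increment leading into round \<open>t\<close>. At a break the
  value may jump freely, while the slope recorded there must already be that of the run that
  begins.\<close>

lemma piecewise_affine_regret:
  assumes B: "1 \<in> B" "B \<subseteq> {1..n}"
    and step: "\<And>t k. 2 \<le> t \<Longrightarrow> t \<le> n \<Longrightarrow> t \<notin> B \<Longrightarrow> k < d \<Longrightarrow>
      u t k = u (t - 1) k + v t k \<and> v t k = v (t - 1) k"
    and bd: "\<And>t k. 1 \<le> t \<Longrightarrow> t \<le> n \<Longrightarrow> k < d \<Longrightarrow> \<bar>u t k\<bar> \<le> 2"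
  shows "(\<Sum>t=1..n. f t (flh_sions d \<sigma> 2 20 f t) - f t (vec d (u t))) \<le> real (card B) * run_regret \<sigma> d n"
proof (rule sum_le_card_breaks[OF _ B])
  fix a b assume ab: "1 \<le> a" "a \<le> b" "b \<le> n" and gap: "{a<..b} \<inter> B = {}"
  have run: "v t k = v a k \<and> u t k = u a k + real (t - a) * v a k" if t: "a \<le> t" "t \<le> b" and k: "k < d" for t k
    using t
  proof (induction t rule: dec_induct)
    case (step t)
    have "Suc t \<in> {a<..b}" using step by auto
    then have "Suc t \<notin> B" using gap by blast
    then have "u (Suc t) k = u t k + v (Suc t) k \<and> v (Suc t) k = v t k"
      using assms(3)[of "Suc t" k] step ab k by auto
    then show ?case using step by (auto simp: of_nat_diff algebra_simps)
  qed simp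
  show "(\<Sum>t=a..b. f t (flh_sions d \<sigma> 2 20 f t) - f t (vec d (u t))) \<le> run_regret \<sigma> d n"
  proof (rule affine_run_regret[where \<beta> = "v a", OF ab])
    show "\<bar>u t k\<bar> \<le> 2" if "a \<le> t" "t \<le> b" "k < d" for t k using that ab by (intro bd) auto
  qed (use run in blast)
qed

text \<open>\<open>c\<close> dominates the number of breaks and has the computable mean
  \<open>s\<close>. Each offset gives the run bound plus a first-order term plus a squared error;
  the first-order term is linear in \<open>U\<close>, so averaging removes it. The bound
  \<open>e \<le> 1\<close> keeps the realisations within 2.\<close>

lemma randomized_comparator_regret:
  fixes w :: "nat \<Rightarrow> real vec" and U V :: "real \<Rightarrow> nat \<Rightarrow> nat \<Rightarrow> real"
  assumes n: "n \<ge> 1" and w: "\<And>t. 1 \<le> t \<Longrightarrow> t \<le> n \<Longrightarrow> w t \<in> cube d 1"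
    and B: "\<And>u. 0 \<le> u \<Longrightarrow> u < 1 \<Longrightarrow> 1 \<in> B u \<and> B u \<subseteq> {1..n} \<and> real (card (B u)) \<le> c u"
    and step: "\<And>u t k. 0 \<le> u \<Longrightarrow> u < 1 \<Longrightarrow> 2 \<le> t \<Longrightarrow> t \<le> n \<Longrightarrow> t \<notin> B u \<Longrightarrow> k < d \<Longrightarrow>
      U u t k = U u (t - 1) k + V u t k \<and> V u t k = V u (t - 1) k"
    and err: "\<And>u t k. 0 \<le> u \<Longrightarrow> u < 1 \<Longrightarrow> 1 \<le> t \<Longrightarrow> t \<le> n \<Longrightarrow> k < d \<Longrightarrow> \<bar>U u t k - w t $ k\<bar> \<le> e"
    and e: "0 \<le> e" "e \<le> 1"
    and mean: "\<And>t k. 1 \<le> t \<Longrightarrow> t \<le> n \<Longrightarrow> k < d \<Longrightarrow> equispaced_mean (\<lambda>u. U u t k) (w t $ k)"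
    and c: "equispaced_mean c s"
  shows "(\<Sum>t=1..n. f t (flh_sions d \<sigma> 2 20 f t) - f t (w t)) \<le> s * run_regret \<sigma> d n + real n * real d * e\<^sup>2"
proof -
  define R where "R = run_regret \<sigma> d n"
  define G where "G t = grad d (f t) (w t)" for t
  have w20: "w t \<in> cube d 20" if "1 \<le> t" "t \<le> n" for t using w[OF that] cube_mono[of 1 20 d] by auto
  have wk: "\<bar>w t $ k\<bar> \<le> 1" if "1 \<le> t" "t \<le> n" "k < d" for t k using w that by (auto simp: cube_def)
  have Ub: "\<bar>U u t k\<bar> \<le> 2" if "0 \<le> u" "u < 1" "1 \<le> t" "t \<le> n" "k < d" for u t k
    using err[OF that] wk[of t k] that e by linarith
  have bound: "(\<Sum>t=1..n. f t (flh_sions d \<sigma> 2 20 f t) - f t (w t))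
      \<le> R * c u + ((\<Sum>t=1..n. \<Sum>k<d. G t $ k * (U u t k + - (w t $ k))) + real n * real d * e\<^sup>2)"
    if u: "0 \<le> u" "u < 1" for u
  proof -
    have "(\<Sum>t=1..n. f t (flh_sions d \<sigma> 2 20 f t) - f t (vec d (U u t))) \<le> real (card (B u)) * R"
      unfolding R_def using B[OF u] step[OF u] Ub[OF u]
      by (intro piecewise_affine_regret[where v = "V u"]) auto
    also have "\<dots> \<le> c u * R" using B[OF u] run_regret_nonneg[OF sg n] by (intro mult_right_mono) (auto simp: R_def)
    finally have 1: "(\<Sum>t=1..n. f t (flh_sions d \<sigma> 2 20 f t) - f t (vec d (U u t))) \<le> R * c u"
      by (simp add: mult.commute)
    have "f t (vec d (U u t)) - f t (w t) \<le> (\<Sum>k<d. G t $ k * (U u t k + - (w t $ k))) + d * e\<^sup>2"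
      if t: "1 \<le> t" "t \<le> n" for t
    proof -
      have x: "vec d (U u t) \<in> cube d 20" using Ub[OF u t] by (force simp: cube_def)
      have wc: "w t \<in> carrier_vec d" using w[OF t] by (simp add: cube_def)
      have gl: "gradient_lipschitz_loss d (f t)" using loss t by auto
      have "l2norm (vec d (U u t) - w t) \<le> e * sqrt d"
        using err[OF u t] wc e by (intro l2norm_le_sqrt) auto
      then have "(l2norm (vec d (U u t) - w t))\<^sup>2 \<le> (e * sqrt d)\<^sup>2" by (intro power_mono l2norm_nonneg)
      moreover have "G t \<bullet> (vec d (U u t) - w t) = (\<Sum>k<d. G t $ k * (U u t k + - (w t $ k)))"
        using wc by (subst scalar_prod_lessThan[of _ d]) (auto intro!: sum.cong)
      ultimately show ?thesis
        using smooth_upper_bound[OF gl w20[OF t] x] by (simp add: G_def power_mult_distrib mult.commute)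
    qed
    then have "(\<Sum>t=1..n. f t (vec d (U u t)) - f t (w t))
        \<le> (\<Sum>t=1..n. (\<Sum>k<d. G t $ k * (U u t k + - (w t $ k))) + d * e\<^sup>2)"
      by (intro sum_mono) auto
    also have "\<dots> = (\<Sum>t=1..n. \<Sum>k<d. G t $ k * (U u t k + - (w t $ k))) + real n * real d * e\<^sup>2"
      by (simp add: sum.distrib)
    finally show ?thesis using 1 by (simp add: sum_subtractf)
  qed
  \<comment> \<open>Inserting the means turns the gradient sum into one over \<open>w - w\<close>,
    which vanishes.\<close>
  have "equispaced_mean
      (\<lambda>u. R * c u + ((\<Sum>t=1..n. \<Sum>k<d. G t $ k * (U u t k + - (w t $ k))) + real n * real d * e\<^sup>2))
      (R * s + ((\<Sum>t=1..n. \<Sum>k<d. G t $ k * (w t $ k + - (w t $ k))) + real n * real d * e\<^sup>2))"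
    by (intro equispaced_mean_add equispaced_mean_cmult equispaced_mean_sum equispaced_mean_const c mean) auto
  from equispaced_mean_le[OF equispaced_mean_const this bound]
  show ?thesis by (simp add: R_def mult.commute)
qed

text \<open>Predictions within 20 and comparators within 1 are at most \<open>21 * sqrt d\<close>
  apart. This serves the regime where the target rate exceeds \<open>n\<close>.\<close>

lemma trivial_regret:
  assumes w: "\<And>t. 1 \<le> t \<Longrightarrow> t \<le> n \<Longrightarrow> w t \<in> cube d 1"
  shows "(\<Sum>t=1..n. f t (flh_sions d \<sigma> 2 20 f t) - f t (w t)) \<le> real n * (21 * real d)"
proof -
  have "f t (flh_sions d \<sigma> 2 20 f t) - f t (w t) \<le> 21 * d" if t: "1 \<le> t" "t \<le> n" for t
  proof -
    let ?p = "flh_sions d \<sigma> 2 20 f t"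
    have p: "?p \<in> cube d 20" using flh_sions_cube[OF t] .
    have w20: "w t \<in> cube d 20" using w[OF t] cube_mono[of 1 20 d] by auto
    have "\<bar>(?p - w t) $ k\<bar> \<le> 21" if "k < d" for k
    proof -
      have "\<bar>?p $ k\<bar> \<le> 20" "\<bar>w t $ k\<bar> \<le> 1" using p w[OF t] that by (auto simp: cube_def)
      then show ?thesis using that cube_carrier[OF w20] by simp
    qed
    then have "l2norm (?p - w t) \<le> 21 * sqrt d"
      using cube_carrier[OF p] cube_carrier[OF w20] by (intro l2norm_le_sqrt) auto
    also have "\<dots> \<le> 21 * d" using d by (simp add: real_le_lsqrt power2_eq_square)
    finally show ?thesis using loss[OF t] p w20 unfolding lipschitz_loss_def by fastforce
  qed
  then have "(\<Sum>t=1..n. f t (flh_sions d \<sigma> 2 20 f t) - f t (w t)) \<le> (\<Sum>t=1..n. 21 * real d)"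
    by (intro sum_mono) auto
  then show ?thesis by simp
qed

text \<open>All slopes are 0, and a break is a round where some coordinate changes its grid point;
  the mean number of grid steps is the total variation over \<open>\<delta>\<close>.\<close>

lemma first_order_regret:
  fixes \<delta> :: real
  assumes n: "n \<ge> 1" and w: "\<And>t. 1 \<le> t \<Longrightarrow> t \<le> n \<Longrightarrow> w t \<in> cube d 1"
    and \<delta>: "0 < \<delta>" "\<delta> \<le> 1"
  shows "(\<Sum>t=1..n. f t (flh_sions d \<sigma> 2 20 f t) - f t (w t))
    \<le> (1 + (\<Sum>t=2..n. \<Sum>k<d. \<bar>w t $ k - w (t - 1) $ k\<bar>) / \<delta>) * run_regret \<sigma> d n + real n * real d * \<delta>\<^sup>2"
proof -
  define F where "F u t k = \<lfloor>w t $ k / \<delta> + u\<rfloor>" for u t k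
  define B where "B u = insert 1 {t \<in> {2..n}. \<exists>k<d. F u t k \<noteq> F u (t - 1) k}" for u
  define c where "c u = 1 + (\<Sum>t=2..n. \<Sum>k<d. \<bar>real_of_int (F u t k) - real_of_int (F u (t - 1) k)\<bar>)" for u
  have "equispaced_mean c (1 + (\<Sum>t=2..n. \<Sum>k<d. \<bar>w t $ k / \<delta> - w (t - 1) $ k / \<delta>\<bar>))"
    unfolding c_def F_def
    by (intro equispaced_mean_add equispaced_mean_sum equispaced_mean_const equispaced_mean_floor_diff)
  moreover have "(\<Sum>t=2..n. \<Sum>k<d. \<bar>w t $ k / \<delta> - w (t - 1) $ k / \<delta>\<bar>)
      = (\<Sum>t=2..n. \<Sum>k<d. \<bar>w t $ k - w (t - 1) $ k\<bar>) / \<delta>"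
    using \<delta> by (simp add: sum_divide_distrib diff_divide_distrib[symmetric])
  ultimately have mean: "equispaced_mean c (1 + (\<Sum>t=2..n. \<Sum>k<d. \<bar>w t $ k - w (t - 1) $ k\<bar>) / \<delta>)" by simp
  show ?thesis
  proof (rule randomized_comparator_regret[where U = "\<lambda>u t k. round_to \<delta> u (w t $ k)" and V = "\<lambda>_ _ _. 0"
        and B = B and c = c, OF n w])
    fix u :: real
    have "real (card (B u)) \<le> 1 + real (card {t \<in> {2..n}. \<exists>k<d. F u t k \<noteq> F u (t - 1) k})"
      unfolding B_def by (subst card_insert_if) auto
    also have "\<dots> \<le> c u"
      unfolding c_def using card_changes_le[of "{2..n}" d "F u" "\<lambda>t. F u (t - 1)"] by simp
    finally show "1 \<in> B u \<and> B u \<subseteq> {1..n} \<and> real (card (B u)) \<le> c u"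
      using n by (auto simp: B_def)
  next
    fix u :: real and t k assume "2 \<le> t" "t \<le> n" "t \<notin> B u" "k < d"
    then show "round_to \<delta> u (w t $ k) = round_to \<delta> u (w (t - 1) $ k) + 0 \<and> (0::real) = 0"
      by (auto simp: B_def F_def round_to_def)
  qed (use \<delta> mean round_to_error equispaced_mean_round_to in auto)
qed

text \<open>There are at most \<open>n / L + 1\<close> blocks, and round 2 is one further break.
  Within a block fewer than \<open>L\<close> slopes, each off by at most \<open>\<delta>\<close>,
  are summed up.\<close>

lemma second_order_regret:
  fixes \<delta> e :: real
  assumes n: "n \<ge> 1" and w: "\<And>t. 1 \<le> t \<Longrightarrow> t \<le> n \<Longrightarrow> w t \<in> cube d 1"
    and \<delta>: "0 < \<delta>" and L: "1 \<le> L" "real L * \<delta> \<le> e" "e \<le> 1"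
  shows "(\<Sum>t=1..n. f t (flh_sions d \<sigma> 2 20 f t) - f t (w t))
    \<le> (real n / real L + 2 + (\<Sum>t=3..n. \<Sum>k<d. \<bar>(w t $ k - w (t - 1) $ k) - (w (t - 1) $ k - w (t - 2) $ k)\<bar>) / \<delta>)
      * run_regret \<sigma> d n + real n * real d * e\<^sup>2"
proof -
  define s where "s t k = w t $ k - w (t - 1) $ k" for t k
  define F where "F u t k = \<lfloor>s t k / \<delta> + u\<rfloor>" for u t k
  define V where "V u t k = round_to \<delta> u (s t k)" for u t k
  \<comment> \<open>The first round of the block of \<open>t\<close>; blocks have length
    \<open>L\<close> and start at round 1.\<close>
  define a where "a t = 1 + L * ((t - 1) div L)" for t
  define U where "U u t k = w (a t) $ k + (\<Sum>r\<in>{a t<..t}. V u r k)" for u t k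
  define C where "C = {t \<in> {1..n}. L dvd t - 1}"
  \<comment> \<open>Round 2 is always a break: \<open>s 1\<close> involves \<open>w 0\<close>, which
    is no comparator, so a change from \<open>s 1\<close> to \<open>s 2\<close> must not be charged
    to the variation.\<close>
  define B where "B u = C \<union> ({2} \<inter> {1..n}) \<union> {t \<in> {3..n}. \<exists>k<d. F u t k \<noteq> F u (t - 1) k}" for u
  define c where "c u = (real n / real L + 2) + (\<Sum>t=3..n. \<Sum>k<d. \<bar>real_of_int (F u t k) - real_of_int (F u (t - 1) k)\<bar>)" for u
  have "equispaced_mean c ((real n / real L + 2) + (\<Sum>t=3..n. \<Sum>k<d. \<bar>s t k / \<delta> - s (t - 1) k / \<delta>\<bar>))"
    unfolding c_def F_def
    by (intro equispaced_mean_add equispaced_mean_sum equispaced_mean_const equispaced_mean_floor_diff)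
  moreover have "(\<Sum>t=3..n. \<Sum>k<d. \<bar>s t k / \<delta> - s (t - 1) k / \<delta>\<bar>)
      = (\<Sum>t=3..n. \<Sum>k<d. \<bar>(w t $ k - w (t - 1) $ k) - (w (t - 1) $ k - w (t - 2) $ k)\<bar>) / \<delta>"
    using \<delta> by (simp add: sum_divide_distrib diff_divide_distrib[symmetric] s_def numeral_2_eq_2)
  ultimately have mean: "equispaced_mean c (real n / real L + 2 +
      (\<Sum>t=3..n. \<Sum>k<d. \<bar>(w t $ k - w (t - 1) $ k) - (w (t - 1) $ k - w (t - 2) $ k)\<bar>) / \<delta>)" by simp
  have a: "1 \<le> a t" "a t \<le> t" "t < a t + L" if "1 \<le> t" for t
  proof -
    have "(t - 1) mod L < L" using L by simp
    moreover have "L * ((t - 1) div L) + (t - 1) mod L = t - 1" by simp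
    ultimately show "1 \<le> a t" "a t \<le> t" "t < a t + L" using that unfolding a_def by linarith+
  qed
  have cardC: "real (card C) \<le> real n / real L + 1"
  proof -
    have "C \<subseteq> (\<lambda>i. 1 + L * i) ` {0..(n - 1) div L}"
    proof
      fix t assume t: "t \<in> C"
      then obtain i where i: "t - 1 = L * i" by (auto simp: C_def)
      have "t = 1 + L * i" using i t by (auto simp: C_def)
      moreover have "i \<le> (n - 1) div L"
        using i t L by (metis C_def atLeastAtMost_iff diff_le_mono div_le_mono mem_Collect_eq nonzero_mult_div_cancel_left not_one_le_zero)
      ultimately show "t \<in> (\<lambda>i. 1 + L * i) ` {0..(n - 1) div L}" by auto
    qed
    then have "card C \<le> card {0..(n - 1) div L}" using surj_card_le by blast
    then have "real (card C) \<le> real ((n - 1) div L) + 1" by simp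
    also have "real ((n - 1) div L) \<le> real n / real L"
    proof -
      have "real ((n - 1) div L) * real L \<le> real n"
        unfolding of_nat_mult[symmetric] of_nat_le_iff by (rule order.trans[OF div_times_less_eq_dividend]) simp
      then show ?thesis using L by (simp add: field_simps)
    qed
    finally show ?thesis by simp
  qed
  have tel: "w (a t) $ k + (\<Sum>r\<in>{a t<..t}. s r k) = w t $ k" if "1 \<le> t" for t k
  proof -
    have "w x $ k + (\<Sum>r\<in>{x<..t}. s r k) = w t $ k" if "x \<le> t" for x
      using that
    proof (induction t rule: dec_induct)
      case (step t)
      have "{x<..Suc t} = insert (Suc t) {x<..t}" using step by auto
      then show ?case using step by (simp add: s_def)
    qed simp
    then show ?thesis using a[OF that] by simp
  qed
  show ?thesis
  proof (rule randomized_comparator_regret[where U = U and V = V and B = B and c = c, OF n w])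
    fix u :: real
    have "real (card (B u)) \<le> real (card C) + real (card ({2} \<inter> {1..n})) + real (card {t \<in> {3..n}. \<exists>k<d. F u t k \<noteq> F u (t - 1) k})"
      unfolding B_def of_nat_add[symmetric] of_nat_le_iff
      by (intro order.trans[OF card_Un_le] add_mono card_Un_le order.refl)
    moreover have "card ({2} \<inter> {1..n}) \<le> 1" using card_mono[of "{2::nat}" "{2} \<inter> {1..n}"] by simp
    ultimately have "real (card (B u)) \<le> c u"
      unfolding c_def using card_changes_le[of "{3..n}" d "F u" "\<lambda>t. F u (t - 1)"] cardC by simp
    then show "1 \<in> B u \<and> B u \<subseteq> {1..n} \<and> real (card (B u)) \<le> c u"
      using n by (auto simp: B_def C_def)
  next
    fix u :: real and t k assume t: "2 \<le> t" "t \<le> n" "t \<notin> B u" and k: "k < d"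
    have t3: "t \<ge> 3" using t by (cases "t = 2") (auto simp: B_def)
    have nd: "\<not> L dvd t - 1" using t by (auto simp: B_def C_def)
    \<comment> \<open>Without a restart at \<open>t\<close>, the rounds \<open>t - 1\<close> and
      \<open>t\<close> share a block, so the sums defining \<open>U\<close> differ by one
      slope.\<close>
    have "(t - 1) div L = (t - 2) div L"
    proof -
      have "t - 1 = Suc (t - 2)" using t by simp
      then show ?thesis using nd by (metis div_Suc dvd_eq_mod_eq_0)
    qed
    then have at: "a t = a (t - 1)" by (simp add: a_def numeral_2_eq_2)
    have "a t \<le> t - 1" unfolding at using t by (intro a) simp
    then have ins: "{a t<..t} = insert t {a t<..t - 1}" using t by auto
    have "(\<Sum>r\<in>{a t<..t}. V u r k) = V u t k + (\<Sum>r\<in>{a t<..t - 1}. V u r k)"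
      unfolding ins using t by (subst sum.insert) auto
    then have "U u t k = U u (t - 1) k + V u t k"
      unfolding U_def at by simp
    moreover have "V u t k = V u (t - 1) k"
      using t t3 k by (auto simp: B_def F_def V_def round_to_def)
    ultimately show "U u t k = U u (t - 1) k + V u t k \<and> V u t k = V u (t - 1) k" by simp
  next
    fix u :: real and t k assume u: "0 \<le> u" "u < 1" and t: "1 \<le> t" "t \<le> n"
    have "U u t k - w t $ k = (\<Sum>r\<in>{a t<..t}. V u r k - s r k)"
      unfolding U_def tel[OF t(1), of k, symmetric] by (simp add: sum_subtractf)
    also have "\<bar>\<dots>\<bar> \<le> (\<Sum>r\<in>{a t<..t}. \<delta>)"
      unfolding V_def using round_to_error[OF \<delta> u] by (intro order.trans[OF sum_abs] sum_mono)
    also have "\<dots> = real (t - a t) * \<delta>" by simp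
    also have "\<dots> \<le> real L * \<delta>" using a[OF t(1)] \<delta> by (intro mult_right_mono) auto
    finally show "\<bar>U u t k - w t $ k\<bar> \<le> e" using L by simp
  next
    fix t k :: nat assume t: "1 \<le> t" "t \<le> n" "k < d"
    have "equispaced_mean (\<lambda>u. U u t k) (w (a t) $ k + (\<Sum>r\<in>{a t<..t}. s r k))"
      unfolding U_def V_def
      by (intro equispaced_mean_add equispaced_mean_const equispaced_mean_sum equispaced_mean_round_to \<delta>)
    then show "equispaced_mean (\<lambda>u. U u t k) (w t $ k)" using tel[OF t(1)] by simp
  next
    have "0 \<le> real L * \<delta>" using \<delta> by simp
    then show "0 \<le> e" using L by simp
  qed (use L mean in auto)
qed

end

section \<open>Path lengths as sums over rounds\<close>

lemma diff_seq_map_upt: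
  "diff_seq (map w [a..<Suc b]) = map (\<lambda>t. w t - w (t - 1)) [Suc a..<Suc b]"
proof (induction "Suc b - a" arbitrary: a)
  case (Suc m)
  show ?case
  proof (cases "a < b")
    case True
    have "diff_seq (map w [a..<Suc b]) = (w (Suc a) - w a) # diff_seq (map w [Suc a..<Suc b])"
      using True by (simp add: upt_conv_Cons del: upt_Suc)
    also have "diff_seq (map w [Suc a..<Suc b]) = map (\<lambda>t. w t - w (t - 1)) [Suc (Suc a)..<Suc b]"
      using Suc by (intro Suc(1)) auto
    finally show ?thesis using True by (simp add: upt_conv_Cons del: upt_Suc)
  next
    case False
    then have "a = b" using Suc(2) by simp
    then show ?thesis by simp
  qed
qed simp

lemma seq_l1norm_map_upt: "seq_l1norm (map h [a..<Suc b]) = (\<Sum>t=a..b. l1norm (h t))"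
  by (simp add: seq_l1norm_def o_def interv_sum_list_conv_sum_set_nat atLeastLessThanSuc_atLeastAtMost del: upt_Suc)

lemma l1norm_carrier: "x \<in> carrier_vec d \<Longrightarrow> l1norm x = (\<Sum>k<d. \<bar>x $ k\<bar>)"
  by (simp add: l1norm_def)

lemma TV0_map:
  assumes "\<And>t. 1 \<le> t \<Longrightarrow> t \<le> n \<Longrightarrow> w t \<in> carrier_vec d"
  shows "TV0 (map w [1..<Suc n]) = (\<Sum>t=2..n. \<Sum>k<d. \<bar>w t $ k - w (t - 1) $ k\<bar>)"
proof -
  have "l1norm (w t - w (t - 1)) = (\<Sum>k<d. \<bar>w t $ k - w (t - 1) $ k\<bar>)" if "t \<in> {2..n}" for t
  proof -
    have c: "w t \<in> carrier_vec d" "w (t - 1) \<in> carrier_vec d" using assms that by auto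
    then show ?thesis by (subst l1norm_carrier[of _ d]) (auto simp: c[THEN carrier_vecD])
  qed
  then show ?thesis
    unfolding TV0_def diff_seq_map_upt seq_l1norm_map_upt by (simp add: numeral_2_eq_2)
qed

lemma TV1_map:
  assumes "\<And>t. 1 \<le> t \<Longrightarrow> t \<le> n \<Longrightarrow> w t \<in> carrier_vec d"
  shows "TV1 (map w [1..<Suc n]) =
    n * (\<Sum>t=3..n. \<Sum>k<d. \<bar>(w t $ k - w (t - 1) $ k) - (w (t - 1) $ k - w (t - 2) $ k)\<bar>)"
proof -
  have "l1norm ((w t - w (t - 1)) - (w (t - 1) - w (t - 1 - 1)))
      = (\<Sum>k<d. \<bar>(w t $ k - w (t - 1) $ k) - (w (t - 1) $ k - w (t - 2) $ k)\<bar>)" if "t \<in> {3..n}" for t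
  proof -
    have "t - 1 - 1 = t - 2" by simp
    moreover have c: "w t \<in> carrier_vec d" "w (t - 1) \<in> carrier_vec d" "w (t - 2) \<in> carrier_vec d"
      using assms that by auto
    ultimately show ?thesis by (subst l1norm_carrier[of _ d]) (auto simp: carrier_vecD[OF c(2), simplified] carrier_vecD[OF c(3)])
  qed
  then show ?thesis
    \<comment> \<open>\<open>diff_seq_map_upt\<close> indexes differences by their right end, so its
      result has the shape it expects and it rewrites both applications of
      \<open>diff_seq\<close>.\<close>
    unfolding TV1_def diff_seq_map_upt seq_l1norm_map_upt
    by (simp add: numeral_3_eq_3 del: upt_Suc)
qed

text \<open>Clears fractional exponents, so that the rates can be compared after taking third or
  fifth powers.\<close>

lemma powr_divide_power:
  fixes a :: real
  assumes "a \<ge> 0" "p > 0" "q > 0"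
  shows "(a powr (real q / real p)) ^ p = a ^ q"
proof (cases "a = 0")
  case False
  then have "(a powr (real q / real p)) ^ p = a powr real q" using assms by (simp add: powr_power)
  then show ?thesis using False assms by (simp add: powr_realpow)
qed (use assms in \<open>simp add: power_0_left\<close>)

section \<open>Balancing grid width and restart period\<close>

context
  fixes d n :: nat and \<sigma> :: real and f :: "nat \<Rightarrow> real vec \<Rightarrow> real" and w :: "nat \<Rightarrow> real vec"
  assumes d: "d \<ge> 1" and n: "n \<ge> 1" and sg: "\<sigma> > 0"
    and loss: "\<And>t. 1 \<le> t \<Longrightarrow> t \<le> n \<Longrightarrow>
      lipschitz_loss d (f t) \<and> gradient_lipschitz_loss d (f t) \<and> exp_concave_loss d \<sigma> (f t)"
    and w: "\<And>t. 1 \<le> t \<Longrightarrow> t \<le> n \<Longrightarrow> w t \<in> cube d 1"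
begin

text \<open>The summand \<open>21 * d\<close> pays for the regime \<open>K > n\<close>. The factor 5
  is dictated by the slope version, so that both bounds have the same form.\<close>

lemma regret_TV0:
  assumes K: "K = max 1 (real n powr (1/3) * TV0 (map w [1..<Suc n]) powr (2/3))"
  shows "(\<Sum>t=1..n. f t (flh_sions d \<sigma> 2 20 f t) - f t (w t)) \<le> (5 * run_regret \<sigma> d n + 21 * d) * K"
proof -
  note R = run_regret_nonneg[OF sg n, of d]
  have K1: "K \<ge> 1" by (simp add: K)
  define X where "X = TV0 (map w [1..<Suc n])"
  have X: "X = (\<Sum>t=2..n. \<Sum>k<d. \<bar>w t $ k - w (t - 1) $ k\<bar>)"
    unfolding X_def using w by (intro TV0_map) (auto simp: cube_def)
  then have X0: "X \<ge> 0" by (auto intro!: sum_nonneg)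
  show ?thesis
  proof (cases "K \<le> n")
    case False
    then have "real n * (21 * real d) \<le> K * (21 * real d)" by (intro mult_right_mono) auto
    also have "\<dots> \<le> (5 * run_regret \<sigma> d n + 21 * d) * K" using K1 R by (simp add: algebra_simps)
    finally have "real n * (21 * real d) \<le> (5 * run_regret \<sigma> d n + 21 * d) * K" .
    moreover have "(\<Sum>t=1..n. f t (flh_sions d \<sigma> 2 20 f t) - f t (w t)) \<le> real n * (21 * real d)"
      by (rule trivial_regret[OF d sg]) (use loss w in auto)
    ultimately show ?thesis by linarith
  next
    case True
    \<comment> \<open>Makes \<open>n * \<delta>^2 = K\<close>, and \<open>n * X^2 \<le> K^3\<close>
      then says \<open>X \<le> K * \<delta>\<close>. The condition \<open>\<delta> \<le> 1\<close>
      amounts to \<open>K \<le> n\<close>.\<close>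
    define \<delta> where "\<delta> = sqrt (K / n)"
    have \<delta>: "0 < \<delta>" "\<delta> \<le> 1" using K1 n True by (auto simp: \<delta>_def)
    have "real n * X\<^sup>2 = (real n powr (1/3) * X powr (2/3)) ^ 3"
      using X0 powr_divide_power[of "real n" 3 1] powr_divide_power[of X 3 2] by (simp add: power_mult_distrib)
    also have "\<dots> \<le> K ^ 3" unfolding K X_def by (intro power_mono) auto
    finally have "X\<^sup>2 \<le> (K * \<delta>)\<^sup>2"
      using n K1 by (simp add: \<delta>_def power_mult_distrib field_simps power2_eq_square power3_eq_cube)
    then have "X \<le> K * \<delta>" by (rule power2_le_imp_le) (use K1 \<delta> in auto)
    then have XK: "X / \<delta> \<le> K" using \<delta> by (simp add: field_simps)
    have "(\<Sum>t=1..n. f t (flh_sions d \<sigma> 2 20 f t) - f t (w t)) \<le> (1 + X / \<delta>) * run_regret \<sigma> d n + real n * real d * \<delta>\<^sup>2"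
      unfolding X by (rule first_order_regret[OF d sg _ n _ \<delta>]) (use loss w in auto)
    also have "\<dots> \<le> (5 * K) * run_regret \<sigma> d n + d * K"
      using XK K1 R n by (intro add_mono mult_right_mono) (auto simp: \<delta>_def)
    also have "\<dots> \<le> (5 * run_regret \<sigma> d n + 21 * d) * K"
      using K1 by (simp add: algebra_simps)
    finally show ?thesis .
  qed
qed

lemma regret_TV1:
  assumes K: "K = max 1 (real n powr (1/5) * TV1 (map w [1..<Suc n]) powr (2/5))"
  shows "(\<Sum>t=1..n. f t (flh_sions d \<sigma> 2 20 f t) - f t (w t)) \<le> (5 * run_regret \<sigma> d n + 21 * d) * K"
proof -
  note R = run_regret_nonneg[OF sg n, of d]
  have K1: "K \<ge> 1" by (simp add: K)
  define S where "S = (\<Sum>t=3..n. \<Sum>k<d. \<bar>(w t $ k - w (t - 1) $ k) - (w (t - 1) $ k - w (t - 2) $ k)\<bar>)"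
  have X: "TV1 (map w [1..<Suc n]) = n * S"
    unfolding S_def using w by (intro TV1_map) (auto simp: cube_def)
  have S0: "S \<ge> 0" by (auto simp: S_def intro!: sum_nonneg)
  show ?thesis
  proof (cases "K \<le> n")
    case False
    then have "real n * (21 * real d) \<le> K * (21 * real d)" by (intro mult_right_mono) auto
    also have "\<dots> \<le> (5 * run_regret \<sigma> d n + 21 * d) * K" using K1 R by (simp add: algebra_simps)
    finally have "real n * (21 * real d) \<le> (5 * run_regret \<sigma> d n + 21 * d) * K" .
    moreover have "(\<Sum>t=1..n. f t (flh_sions d \<sigma> 2 20 f t) - f t (w t)) \<le> real n * (21 * real d)"
      by (rule trivial_regret[OF d sg]) (use loss w in auto)
    ultimately show ?thesis by linarith
  next
    case True
    \<comment> \<open>Restarting every \<open>n / K\<close> rounds makes about \<open>K\<close>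
      blocks, and an error of \<open>e = sqrt (K / n)\<close> costs \<open>n * e^2 = K\<close>.
      Hence a slope may be off by about \<open>e / L\<close>, that is \<open>K / n\<close> to the
      power 3/2, and \<open>n^3 * S^2 \<le> K^5\<close> then says
      \<open>S \<le> K * \<delta>\<close>.\<close>
    define L where "L = nat \<lfloor>real n / K\<rfloor>"
    define e where "e = sqrt (K / n)"
    define \<delta> where "\<delta> = K / n * e"
    have nK: "real n / K \<ge> 1" using True K1 by simp
    have L1: "L \<ge> 1" using nK by (simp add: L_def le_nat_floor)
    have L: "real L \<le> real n / K" "real n / K < real L + 1" using nK by (auto simp: L_def)
    have e: "0 < e" "e \<le> 1" using K1 n True by (auto simp: e_def)
    have \<delta>: "0 < \<delta>" using K1 n e by (simp add: \<delta>_def)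
    have "real L * \<delta> \<le> real n / K * \<delta>" using L \<delta> by (intro mult_right_mono) auto
    also have "\<dots> = e" using K1 n by (simp add: \<delta>_def)
    finally have Le: "real L * \<delta> \<le> e" .
    have "real n * (n * S)\<^sup>2 = (real n powr (1/5) * (n * S) powr (2/5)) ^ 5"
      using S0 powr_divide_power[of "real n" 5 1] powr_divide_power[of "n * S" 5 2]
      by (simp only: power_mult_distrib) simp
    also have "\<dots> \<le> K ^ 5" unfolding K X by (intro power_mono) auto
    finally have "real n ^ 3 * S\<^sup>2 \<le> K ^ 5" by (simp add: power_mult_distrib power2_eq_square power3_eq_cube mult_ac)
    then have "S\<^sup>2 \<le> K ^ 5 / real n ^ 3" using n by (simp add: pos_le_divide_eq mult.commute)
    also have "K ^ 5 / real n ^ 3 = (K * \<delta>)\<^sup>2"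
    proof -
      have "(K * \<delta>)\<^sup>2 = K ^ 4 / real n ^ 2 * e\<^sup>2" by (simp add: \<delta>_def eval_nat_numeral)
      also have "e\<^sup>2 = K / n" using K1 n by (simp add: e_def)
      finally show ?thesis by (simp add: eval_nat_numeral)
    qed
    finally have "S \<le> K * \<delta>" by (rule power2_le_imp_le) (use K1 \<delta> in auto)
    then have SK: "S / \<delta> \<le> K" using \<delta> by (simp add: field_simps)
    \<comment> \<open>Rounding \<open>n / K \<ge> 1\<close> down loses at most a factor 2.\<close>
    have "real n / K \<le> 2 * real L" using L L1 by linarith
    then have nL: "real n / real L \<le> 2 * K" using K1 L1 by (simp add: field_simps)
    have "(\<Sum>t=1..n. f t (flh_sions d \<sigma> 2 20 f t) - f t (w t))
        \<le> (real n / real L + 2 + S / \<delta>) * run_regret \<sigma> d n + real n * real d * e\<^sup>2"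
      unfolding S_def by (rule second_order_regret[OF d sg _ n _ \<delta> L1 Le e(2)]) (use loss w in auto)
    \<comment> \<open>\<open>2 * K\<close> from the blocks, 2 extra breaks and \<open>K\<close> from
      slope changes make at most \<open>5 * K\<close>, as \<open>K \<ge> 1\<close>.\<close>
    also have "\<dots> \<le> (5 * K) * run_regret \<sigma> d n + d * K"
      using SK nL K1 R n by (intro add_mono mult_right_mono) (auto simp: e_def)
    also have "\<dots> \<le> (5 * run_regret \<sigma> d n + 21 * d) * K"
      using K1 by (simp add: algebra_simps)
    finally show ?thesis .
  qed
qed

end

theorem proposition5:
  fixes \<sigma> :: real
  assumes "\<sigma> > 0"
  shows "\<exists>K>0. \<forall>(d::nat) (n::nat) (W::real vec set) (f::nat \<Rightarrow> real vec \<Rightarrow> real).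
    d \<ge> 1 \<longrightarrow> n \<ge> 1 \<longrightarrow>
    W \<subseteq> cube d 1 \<longrightarrow>
    (\<forall>t\<in>{1..n}. lipschitz_loss d (f t) \<and> gradient_lipschitz_loss d (f t) \<and>
                exp_concave_loss d \<sigma> (f t)) \<longrightarrow>
    (\<forall>w::nat \<Rightarrow> real vec. (\<forall>t\<in>{1..n}. w t \<in> W) \<longrightarrow>
      (let ws = map w [1..<Suc n] in
        (\<Sum>t=1..n. f t (flh_sions d \<sigma> 2 20 f t) - f t (w t))
          \<le> K * (1 + ln (real n)) powr K *
             max ((real d)\<^sup>2 * min (real n powr (1/5) * TV1 ws powr (2/5))
                                   (real n powr (1/3) * TV0 ws powr (2/3)))
                 ((real d)\<^sup>2)))"
proof -
  \<comment> \<open>\<open>c\<close> is the constant of \<open>run_regret_le\<close>; 5 and 21 come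
    from the common form of the two path length bounds.\<close>
  define c where "c = 7 / \<sigma> + 73"
  define K where "K = 5 * c + 21"
  have K: "K \<ge> 1" using assms by (simp add: K_def c_def)
  show ?thesis
  proof (intro exI[of _ K] conjI allI impI, unfold Let_def)
    fix d n :: nat and W :: "real vec set" and f :: "nat \<Rightarrow> real vec \<Rightarrow> real" and w :: "nat \<Rightarrow> real vec"
    assume d: "d \<ge> 1" and n: "n \<ge> 1" and W: "W \<subseteq> cube d 1"
      and loss: "\<forall>t\<in>{1..n}. lipschitz_loss d (f t) \<and> gradient_lipschitz_loss d (f t) \<and> exp_concave_loss d \<sigma> (f t)"
      and w: "\<forall>t\<in>{1..n}. w t \<in> W"
    let ?ws = "map w [1..<Suc n]"
    let ?Q = "\<Sum>t=1..n. f t (flh_sions d \<sigma> 2 20 f t) - f t (w t)"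
    let ?R = "run_regret \<sigma> d n"
    define X where "X = real n powr (1/5) * TV1 ?ws powr (2/5)"
    define Y where "Y = real n powr (1/3) * TV0 ?ws powr (2/3)"
    define l where "l = 1 + ln (real n)"
    have l: "l \<ge> 1" using n by (simp add: l_def)
    have loss': "lipschitz_loss d (f t) \<and> gradient_lipschitz_loss d (f t) \<and> exp_concave_loss d \<sigma> (f t)"
      if "1 \<le> t" "t \<le> n" for t using loss that by auto
    have w': "w t \<in> cube d 1" if "1 \<le> t" "t \<le> n" for t using w W that by auto
    have "?Q \<le> (5 * ?R + 21 * d) * max 1 X"
      unfolding X_def by (rule regret_TV1[OF d n assms _ _ refl]) (use loss' w' in auto)
    moreover have "?Q \<le> (5 * ?R + 21 * d) * max 1 Y"
      unfolding Y_def by (rule regret_TV0[OF d n assms _ _ refl]) (use loss' w' in auto)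
    ultimately have "?Q \<le> (5 * ?R + 21 * d) * max 1 (min X Y)"
      by (cases "X \<le> Y") (auto simp: min_def)
    also have "\<dots> \<le> (K * l * (real d)\<^sup>2) * max 1 (min X Y)"
    proof (rule mult_right_mono)
      have "real d * 1 \<le> (real d)\<^sup>2 * l"
        unfolding power2_eq_square using d l by (intro mult_mono) (auto simp: mult_le_cancel_left1)
      moreover have "?R \<le> (real d)\<^sup>2 * l * c"
        unfolding l_def c_def by (rule run_regret_le[OF assms d n])
      ultimately have "5 * ?R + 21 * d \<le> 5 * ((real d)\<^sup>2 * l * c) + 21 * ((real d)\<^sup>2 * l)" by simp
      then show "5 * ?R + 21 * d \<le> K * l * (real d)\<^sup>2" by (simp add: K_def algebra_simps)
    qed simp
    also have "\<dots> = K * l * max ((real d)\<^sup>2 * min X Y) ((real d)\<^sup>2)"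
    proof -
      have "(real d)\<^sup>2 * max 1 (min X Y) = max ((real d)\<^sup>2 * min X Y) ((real d)\<^sup>2)"
        by (simp add: max_mult_distrib_left max.commute)
      then show ?thesis by (simp only: mult.assoc)
    qed
    \<comment> \<open>The same \<open>K\<close> serves as factor and as exponent:
      \<open>l \<le> l powr K\<close> because \<open>l \<ge> 1\<close> and
      \<open>K \<ge> 1\<close>.\<close>
    also have "\<dots> \<le> K * l powr K * max ((real d)\<^sup>2 * min X Y) ((real d)\<^sup>2)"
      using K l powr_mono[of 1 K l] by (intro mult_right_mono mult_left_mono) (auto simp: le_max_iff_disj)
    finally show "?Q \<le> K * (1 + ln (real n)) powr K * max ((real d)\<^sup>2 *
        min (real n powr (1/5) * TV1 ?ws powr (2/5)) (real n powr (1/3) * TV0 ?ws powr (2/3))) ((real d)\<^sup>2)"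
      by (simp add: X_def Y_def l_def)
  qed (use K in simp)
qed

end
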